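(* Let $\mathbb{P}$ be one of the following forcing notions: Sacks forcing $\mathbb{S}$, Miller forcing $\mathbb{M}$, Matet forcing $\mathbb{T}$, Přikrý–Silver forcing $\mathbb{V}$, Willowtree forcing $\mathbb{W}$, Laver forcing $\mathbb{L}$. Then every analytic set of reals is $\mathbb{P}$-measurable; that is, for every analytic set $A$ (with $A\subseteq\omega^\omega$ for $\mathbb{M},\mathbb{L},\mathbb{T}$ and $A\subseteq 2^\omega$ for $\mathbb{S},\mathbb{V},\mathbb{W}$) and every $p\in\mathbb{P}$ there is $p'\in\mathbb{P}$ with $p'\le p$ such that $[p']\cap A=\emptyset$ or $[p']\subseteq A$.
   Context: A tree is a subset $T$ of $\omega^{<\omega}$ closed under initial segments; here all trees are nonempty. $[T]$ denotes the set of branches, i.e. of all $x\in\omega^\omega$ with $x|_n\in T$ for all $n$. A node of $T$ is a splitting node if it has more than one immediate successor in $T$, and an $\omega$-splitting node if it has infinitely many immediate successors in $T$. For forcings whose conditions are trees, $p'\le p$ means $p'\subseteq p$. $\mathbb{L}$ (Laver): the set of all trees $L\subseteq\omega^{<\omega}$ for which there is a node $s\in L$ (the stem) such that every node of $L$ is comparable with $s$ and every node of $L$ extending $s$ (including $s$) is $\omega$-splitting; ordered by inclusion. $\mathbb{M}$ (Miller): the set of all superperfect trees $M\subseteq\omega^{<\omega}$, i.e. trees in which every splitting node is $\omega$-splitting and every node is extended by some splitting node; ordered by inclusion. $\mathbb{S}$ (Sacks): the set of all perfect trees $P\subseteq 2^{<\omega}$, i.e. trees in which every node is extended by some splitting node;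 ordered by inclusion. $\mathbb{V}$ (Přikrý–Silver): the set of all uniform perfect trees $P\subseteq 2^{<\omega}$, i.e. perfect trees such that whenever $t_1,t_2\in P$ have the same length, then for each $i\in\{0,1\}$: $t_1{}^\frown\langle i\rangle\in P\iff t_2{}^\frown\langle i\rangle\in P$; ordered by inclusion. $\mathbb{T}$ (Matet): let $\omega^{\uparrow<\omega}$ be the set of finite strictly increasing sequences of natural numbers. Conditions are pairs $\langle s,A\rangle$ with $s\in\omega^{\uparrow<\omega}$ and $A$ an infinite countable set of nonempty elements of $\omega^{\uparrow<\omega}$ such that $\{s\}\cup A$ has an enumeration $(a_i)_{i\in\omega}$ with $a_0=s$ and $\min(\mathrm{ran}(a_{i+1}))>\max(\mathrm{ran}(a_i))$ for all $i$ (no requirement on $\max$ if $a_0=s=\emptyset$). The order is: $\langle s,A\rangle\le\langle t,B\rangle$ iff $s\supseteq t$, every $a\in A$ is of the form $a=b_1{}^\frown\cdots{}^\frown b_n$ with $b_1,\dots,b_n\in B$, and there is a finite (possibly empty) set $\{\beta_1,\dots,\beta_m\}\subseteq B$ with $\mathrm{ran}(s)\setminus\mathrm{ran}(t)=\mathrm{ran}(\beta_1{}^\frown\cdots{}^\frown\beta_m)$. The set $[\langle s,A\rangle]$ consists of all $x\in\omega^\omega$ such that $x=s^\frown c_1{}^\frown c_2{}^\frown\cdots$ for some infinite subset $\{c_1,c_2,\dots\}$ of $A$. $\mathbb{W}$ (Willowtree): conditions are pairs $\langle f,A\rangle$ where $A$ is an infinite set of pairwise disjoint nonempty finite subsets of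 $\omega$ and $f:\omega\setminus\bigcup A\to 2$. The set $[\langle f,A\rangle]$ consists of all $x\in 2^\omega$ such that $x\supseteq f$ and $x$ is constant on each $a\in A$. The order is: $\langle g,B\rangle\le\langle f,A\rangle$ iff $[\langle g,B\rangle]\subseteq[\langle f,A\rangle]$ (equivalently, inclusion of the corresponding trees of finite initial segments). *)

theory Defs
  imports "HOL-Analysis.Analysis" "HOL-Library.Sublist" "HOL-Library.Disjoint_Sets"
begin

section \<open>Analytic sets\<close>

text \<open>
  The Baire space is the type \<^typ>\<open>nat \<Rightarrow> nat\<close> and the Cantor space is \<^typ>\<open>nat \<Rightarrow> bool\<close>, with
  \<^const>\<open>False\<close> and \<^const>\<open>True\<close> playing the roles of 0 and 1. Function types carry the product
  topology, \<^typ>\<open>nat\<close> and \<^typ>\<open>bool\<close> the discrete one.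
\<close>

definition analytic_set :: "'a::topological_space set \<Rightarrow> bool" where
  "analytic_set A \<longleftrightarrow>
     A = {} \<or> (\<exists>f :: (nat \<Rightarrow> nat) \<Rightarrow> 'a. continuous_on UNIV f \<and> A = range f)"

section \<open>Measurability with respect to a forcing notion\<close>

definition forcing_measurable ::
    "'p set \<Rightarrow> ('p \<Rightarrow> 'p \<Rightarrow> bool) \<Rightarrow> ('p \<Rightarrow> 'x set) \<Rightarrow> 'x set \<Rightarrow> bool" where
  "forcing_measurable P le body A \<longleftrightarrow>
     (\<forall>p\<in>P. \<exists>p'\<in>P. le p' p \<and> (body p' \<inter> A = {} \<or> body p' \<subseteq> A))"

section \<open>Trees\<close>

definition restr :: "(nat \<Rightarrow> 'a) \<Rightarrow> nat \<Rightarrow> 'a list" where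
  "restr x n = map x [0..<n]"

definition is_tree :: "'a list set \<Rightarrow> bool" where
  "is_tree T \<longleftrightarrow> T \<noteq> {} \<and> (\<forall>t\<in>T. \<forall>s. prefix s t \<longrightarrow> s \<in> T)"

definition branches :: "'a list set \<Rightarrow> (nat \<Rightarrow> 'a) set" where
  "branches T = {x. \<forall>n. restr x n \<in> T}"

definition imm_succs :: "'a list set \<Rightarrow> 'a list \<Rightarrow> 'a list set" where
  "imm_succs T t = {u \<in> T. \<exists>i. u = t @ [i]}"

definition splitting_node :: "'a list set \<Rightarrow> 'a list \<Rightarrow> bool" where
  "splitting_node T t \<longleftrightarrow> t \<in> T \<and> (\<exists>u \<in> imm_succs T t. \<exists>v \<in> imm_succs T t. u \<noteq> v)"

definition omega_splitting_node :: "'a list set \<Rightarrow> 'a list \<Rightarrow> bool" where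
  "omega_splitting_node T t \<longleftrightarrow> t \<in> T \<and> infinite (imm_succs T t)"

section \<open>Laver, Miller, Sacks and Prikry--Silver forcing\<close>

definition laver :: "nat list set set" where
  "laver = {L. is_tree L \<and>
     (\<exists>s\<in>L. (\<forall>t\<in>L. prefix s t \<or> prefix t s) \<and>
            (\<forall>t\<in>L. prefix s t \<longrightarrow> omega_splitting_node L t))}"

definition miller :: "nat list set set" where
  "miller = {M. is_tree M \<and>
     (\<forall>t. splitting_node M t \<longrightarrow> omega_splitting_node M t) \<and>
     (\<forall>t\<in>M. \<exists>u. prefix t u \<and> splitting_node M u)}"

definition sacks :: "bool list set set" where
  "sacks = {P. is_tree P \<and> (\<forall>t\<in>P. \<exists>u. prefix t u \<and> splitting_node P u)}"

definition silver :: "bool list set set" where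
  "silver = {P \<in> sacks.
     \<forall>t1\<in>P. \<forall>t2\<in>P. length t1 = length t2 \<longrightarrow>
       (\<forall>i. t1 @ [i] \<in> P \<longleftrightarrow> t2 @ [i] \<in> P)}"

section \<open>Matet forcing\<close>

text \<open>Finite strictly increasing sequences are lists \<open>s\<close> with \<open>sorted_wrt (<) s\<close>, and
  \<open>ran s\<close> is \<open>set s\<close>.\<close>

definition block_less :: "nat list \<Rightarrow> nat list \<Rightarrow> bool" where
  "block_less a b \<longleftrightarrow> (a \<noteq> [] \<longrightarrow> Max (set a) < Min (set b))"

definition matet :: "(nat list \<times> nat list set) set" where
  "matet = {(s, A). sorted_wrt (<) s \<and> infinite A \<and>
     (\<forall>a\<in>A. a \<noteq> [] \<and> sorted_wrt (<) a) \<and>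
     (\<exists>a :: nat \<Rightarrow> nat list. range a = insert s A \<and> a 0 = s \<and>
        (\<forall>i. block_less (a i) (a (Suc i))))}"

definition matet_le :: "nat list \<times> nat list set \<Rightarrow> nat list \<times> nat list set \<Rightarrow> bool" where
  "matet_le p q = (case (p, q) of ((s, A), (t, B)) \<Rightarrow>
     prefix t s \<and>
     (\<forall>a\<in>A. \<exists>bs. set bs \<subseteq> B \<and> a = concat bs) \<and>
     (\<exists>\<beta>s. set \<beta>s \<subseteq> B \<and> set s - set t = set (concat \<beta>s)))"

text \<open>
  The infinite subset \<open>{c\<^sub>1, c\<^sub>2, \<dots>}\<close> of \<open>A\<close> is concatenated in its natural (block)
  order, not in an arbitrary one. Since the \<open>c i\<close> are nonempty, the condition on initial segments
  says precisely that \<open>x\<close> is the infinite concatenation of \<open>s\<close> and the \<open>c i\<close>.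
\<close>

definition matet_body :: "nat list \<times> nat list set \<Rightarrow> (nat \<Rightarrow> nat) set" where
  "matet_body p = (case p of (s, A) \<Rightarrow>
     {x. \<exists>c :: nat \<Rightarrow> nat list.
           range c \<subseteq> A \<and> (\<forall>i. block_less (c i) (c (Suc i))) \<and>
           (\<forall>n. let u = s @ concat (map c [0..<n]) in restr x (length u) = u)})"

section \<open>Willowtree forcing\<close>

definition willowtree :: "((nat \<rightharpoonup> bool) \<times> nat set set) set" where
  "willowtree = {(f, A). infinite A \<and> disjoint A \<and>
     (\<forall>a\<in>A. finite a \<and> a \<noteq> {}) \<and> dom f = UNIV - \<Union>A}"

definition willowtree_body :: "(nat \<rightharpoonup> bool) \<times> nat set set \<Rightarrow> (nat \<Rightarrow> bool) set" where
  "willowtree_body p = (case p of (f, A) \<Rightarrow>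
     {x. f \<subseteq>\<^sub>m (\<lambda>n. Some (x n)) \<and> (\<forall>a\<in>A. \<forall>m\<in>a. \<forall>n\<in>a. x m = x n)})"

definition willowtree_le ::
    "(nat \<rightharpoonup> bool) \<times> nat set set \<Rightarrow> (nat \<rightharpoonup> bool) \<times> nat set set \<Rightarrow> bool" where
  "willowtree_le p q \<longleftrightarrow> willowtree_body p \<subseteq> willowtree_body q"

end

theory Submission
  imports Defs
begin

text \<open>
  All six cases are consequences of one theorem, Silver's theorem that analytic sets are Ramsey,
  in the form \<open>analytic_ramsey\<close>: if \<open>\<phi>\<close> is continuous on sequences of numbers and \<open>A\<close> is analytic,
  then for some infinite \<open>H\<close> the images under \<open>\<phi>\<close> of the strictly increasing sequences with values
  in \<open>H\<close> lie all inside or all outside \<open>A\<close>. Given a condition \<open>p\<close>, it therefore suffices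
  (\<open>forcing_measurableI\<close>) to choose \<open>\<phi>\<close> such that for every infinite \<open>H\<close> this image contains the
  body of some condition below \<open>p\<close>.

  The Ramsey theorem is proved by combinatorial forcing. An analytic set pulled back along \<open>\<phi>\<close> is
  the projection of a closed set \<open>C\<close> of pairs \<open>(x, y)\<close>. Consider pairs \<open>(a, t)\<close> of finite
  approximations to \<open>x\<close> and \<open>y\<close>. An infinite set \<open>N\<close> accepts \<open>(a, t)\<close> if no \<open>x\<close> that starts with
  \<open>a\<close> and continues in \<open>N\<close> has a witness \<open>y\<close> extending \<open>t\<close>, and it rejects \<open>(a, t)\<close> if no infinite
  subset accepts it. Diagonalization yields a set \<open>H\<close> deciding all relevant pairs. If \<open>(a, t)\<close> is
  rejected, then along every \<open>x\<close> in \<open>H\<close> some longer pair is rejected too; that this can be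
  achieved uniformly in \<open>x\<close> is an instance of the Ramsey property of open sets
  (\<open>open_completely_ramsey\<close>). Hence, if the empty pair is rejected, every \<open>x\<close> in \<open>H\<close> has rejected
  approximations of unbounded length, which converge to a pair \<open>(x, y)\<close>, and this pair lies in the
  closed set \<open>C\<close>. If it is accepted, no \<open>x\<close> in \<open>H\<close> is in the projection.

  It remains to find the maps \<open>\<phi>\<close>. For Laver and Miller trees, finite sequences of numbers are
  embedded into the tree so that one-step extensions leave a splitting node through distinct
  successors; the increasing sequences in \<open>H\<close> then generate a tree of the same kind. For a Matet
  condition, \<open>\<phi> x\<close> concatenates the blocks with the indices \<open>x 0, x 1, \<dots>\<close>. For the forcings on the
  Cantor space, \<open>x\<close> is first replaced by the indicator of its range: the indicators of infinite
  subsets of \<open>H\<close> contain a cube, namely all sets between \<open>X\<close> and \<open>H\<close>, where \<open>X\<close> consists of every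
  second element of \<open>H\<close>. Sacks and willowtree conditions contain copies of the Cantor space, in
  which a cube becomes a condition of the same kind; Silver conditions correspond to the
  willowtree conditions in which all blocks are singletons.
\<close>

section \<open>Initial segments and the product topology\<close>

lemma length_restr [simp]: "length (restr x n) = n"
  by (simp add: restr_def)

lemma restr_0 [simp]: "restr x 0 = []"
  by (simp add: restr_def)

lemma restr_Suc: "restr x (Suc n) = restr x n @ [x n]"
  by (simp add: restr_def)

lemma nth_restr [simp]: "i < n \<Longrightarrow> restr x n ! i = x i"
  by (simp add: restr_def)

lemma set_restr: "set (restr x n) = x ` {..<n}"
  by (auto simp: restr_def)

lemma restr_eq_iff: "restr x (length u) = u \<longleftrightarrow> (\<forall>i<length u. x i = u ! i)"
  by (metis length_restr nth_equalityI nth_restr)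

lemma restr_cong_iff: "restr x n = restr y n \<longleftrightarrow> (\<forall>i<n. x i = y i)"
  using restr_eq_iff[of x "restr y n"] by simp

lemma take_restr: "m \<le> n \<Longrightarrow> take m (restr x n) = restr x m"
  by (simp add: restr_def take_map)

lemma prefix_restr: "m \<le> n \<Longrightarrow> prefix (restr x m) (restr x n)"
  by (metis take_restr take_is_prefix)

lemma sorted_restr: "strict_mono x \<Longrightarrow> sorted_wrt (<) (restr x n)"
  for x :: "nat \<Rightarrow> nat"
  by (simp add: sorted_wrt_iff_nth_less strict_mono_less)

lemma open_agree: "open {y. \<forall>i<m. y i = x i}"
  for x :: "nat \<Rightarrow> 'a::discrete_topology"
  using product_topology_basis'[of "{..<m}" "\<lambda>i. {x i}" id] by (simp add: open_discrete Ball_def)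

lemma continuous_if_locally_determined:
  fixes \<phi> :: "(nat \<Rightarrow> 'a::discrete_topology) \<Rightarrow> nat \<Rightarrow> 'b::topological_space"
  assumes "\<And>k. \<exists>m. \<forall>x y. restr x m = restr y m \<longrightarrow> \<phi> x k = \<phi> y k"
  shows "continuous_on UNIV \<phi>"
proof (rule continuous_on_coordinatewise_then_product)
  fix k
  obtain m where m: "\<And>x y. restr x m = restr y m \<Longrightarrow> \<phi> x k = \<phi> y k"
    using assms[of k] by blast
  show "continuous_on UNIV (\<lambda>x. \<phi> x k)"
    unfolding continuous_on_open_vimage[OF open_UNIV]
  proof (intro allI impI)
    fix B :: "'b set"
    have "\<exists>T. open T \<and> x \<in> T \<and> T \<subseteq> (\<lambda>x. \<phi> x k) -` B" if "\<phi> x k \<in> B" for x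
    proof (intro exI conjI)
      show "{y. \<forall>i<m. y i = x i} \<subseteq> (\<lambda>x. \<phi> x k) -` B"
        using m that by (auto simp: restr_cong_iff)
    qed (auto simp: open_agree)
    then show "open ((\<lambda>x. \<phi> x k) -` B \<inter> UNIV)"
      by (subst open_subopen) auto
  qed
qed

text \<open>
  Closedness enters the Ramsey theorem through this criterion: finite approximations in the closed
  set suffice.
\<close>

lemma closed_limit_point:
  fixes C :: "((nat \<Rightarrow> 'a::discrete_topology) \<times> (nat \<Rightarrow> 'b::discrete_topology)) set"
  assumes "closed C"
    and approx: "\<And>k. \<exists>x' y'. (x', y') \<in> C \<and> restr x' k = restr x k \<and> restr y' k = restr y k"
  shows "(x, y) \<in> C"
proof (rule ccontr)
  assume "(x, y) \<notin> C"
  then obtain A B where AB: "open A" "open B" "x \<in> A" "y \<in> B" "A \<times> B \<subseteq> - C"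
    using \<open>closed C\<close> by (metis ComplI open_Compl open_prod_elim mem_Times_iff fst_conv snd_conv)
  have nbhd: "\<exists>m. \<forall>z'. restr z' m = restr z m \<longrightarrow> z' \<in> S"
    if S: "open S" "z \<in> S" for S :: "(nat \<Rightarrow> 'c::discrete_topology) set" and z
  proof -
    obtain X where X: "z \<in> Pi\<^sub>E UNIV X" "finite {i. X i \<noteq> UNIV}" "Pi\<^sub>E UNIV X \<subseteq> S"
      using product_topology_open_contains_basis[OF S(1)[unfolded open_fun_def] S(2)] by auto
    obtain m where m: "{i. X i \<noteq> UNIV} \<subseteq> {..<m}"
      using X(2) finite_nat_iff_bounded by blast
    have "z' \<in> S" if "restr z' m = restr z m" for z'
    proof -
      have "z' i \<in> X i" for i
        using that m X(1) by (cases "i < m") (auto simp: restr_cong_iff PiE_iff)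
      then show ?thesis using X(3) by auto
    qed
    then show ?thesis by blast
  qed
  obtain m n where "\<And>x'. restr x' m = restr x m \<Longrightarrow> x' \<in> A" "\<And>y'. restr y' n = restr y n \<Longrightarrow> y' \<in> B"
    using nbhd AB by metis
  moreover obtain x' y' where "(x', y') \<in> C" "restr x' (max m n) = restr x (max m n)"
      "restr y' (max m n) = restr y (max m n)"
    using approx by blast
  ultimately have "x' \<in> A" "y' \<in> B"
    by (metis max.cobounded1 take_restr, metis max.cobounded2 take_restr)
  with \<open>(x', y') \<in> C\<close> AB(5) show False by blast
qed

section \<open>Diagonalization over finite increasing sequences\<close>

definition above :: "nat list \<Rightarrow> nat set \<Rightarrow> nat set" where
  "above a N = {n \<in> N. \<forall>m\<in>set a. m < n}"

lemma above_subset: "above a N \<subseteq> N"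
  by (auto simp: above_def)

lemma infinite_above: "infinite N \<Longrightarrow> infinite (above a N)"
proof -
  assume "infinite N"
  have "N \<subseteq> above a N \<union> (\<Union>m\<in>set a. {..m})"
    by (auto simp: above_def not_less)
  then show ?thesis using \<open>infinite N\<close> by (meson finite_UN_I finite_Un finite_atMost finite_set finite_subset)
qed

lemma finite_increasing_lists:
  fixes B :: "nat set"
  assumes "finite B"
  shows "finite {a. sorted_wrt (<) a \<and> set a \<subseteq> B}"
proof (rule finite_subset)
  show "{a. sorted_wrt (<) a \<and> set a \<subseteq> B} \<subseteq> {a. set a \<subseteq> B \<and> distinct a}"
    using strict_sorted_iff by auto
  show "finite {a. set a \<subseteq> B \<and> distinct a}"
  proof (rule finite_subset)
    show "{a. set a \<subseteq> B \<and> distinct a} \<subseteq> {a. set a \<subseteq> B \<and> length a \<le> card B}"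
      using assms by (auto simp: distinct_card[symmetric] intro: card_mono)
  qed (rule finite_lists_length_le[OF assms])
qed

text \<open>
  The fusion step behind all the Ramsey arguments. If \<open>D a i\<close> depends only on the part of a set
  above \<open>a\<close>, is inherited by infinite subsets and can be achieved by shrinking, then it can be
  achieved for all finite sequences from the final set at once: choose the elements one by one,
  and after each choice shrink the reservoir to treat the finitely many sequences with entries up
  to the chosen element. The index \<open>i\<close> ranges over a countable family of requirements; bounding it
  by the length of \<open>a\<close> keeps every stage finite and costs nothing in the applications, since
  initial segments can be taken as long as needed. The bound \<open>k\<close> admits a given initial segment
  whose entries are not in the final set.
\<close>

lemma diagonalization:
  fixes D :: "nat list \<Rightarrow> nat \<Rightarrow> nat set \<Rightarrow> bool"
  assumes her: "\<And>a i N N'. D a i N \<Longrightarrow> infinite N' \<Longrightarrow> above a N' \<subseteq> N \<Longrightarrow> D a i N'"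
    and dense: "\<And>a i N. sorted_wrt (<) a \<Longrightarrow> infinite N \<Longrightarrow> \<exists>N'\<subseteq>N. infinite N' \<and> D a i N'"
    and "infinite M"
  shows "\<exists>N\<subseteq>M. infinite N \<and>
    (\<forall>a i. sorted_wrt (<) a \<longrightarrow> set a \<subseteq> {..<k} \<union> N \<longrightarrow> i \<le> length a \<longrightarrow> D a i N)"
proof -
  define E where "E n N \<longleftrightarrow> (\<forall>a i. sorted_wrt (<) a \<longrightarrow> set a \<subseteq> {..<n} \<longrightarrow> i \<le> length a \<longrightarrow> D a i N)"
    for n :: nat and N
  have her': "D a i N'" if "D a i N" "infinite N'" "N' \<subseteq> N" for a i N N'
    using her[OF that(1,2)] that(3) above_subset by blast
  have ex_E: "\<exists>N'\<subseteq>N. infinite N' \<and> E n N'" if "infinite N" for n N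
  proof -
    define Q where "Q = (SIGMA a : {a. sorted_wrt (<) a \<and> set a \<subseteq> {..<n}}. {..length a})"
    have "finite Q"
      unfolding Q_def using finite_increasing_lists[of "{..<n}"] by (intro finite_SigmaI) auto
    moreover have "Q \<subseteq> {(a, i). sorted_wrt (<) a}" by (auto simp: Q_def)
    ultimately have "\<exists>N'\<subseteq>N. infinite N' \<and> (\<forall>(a,i)\<in>Q. D a i N')"
    proof (induction Q rule: finite_induct)
      case empty then show ?case using \<open>infinite N\<close> by auto
    next
      case (insert q Q)
      obtain N1 where N1: "N1 \<subseteq> N" "infinite N1" "\<forall>(a,i)\<in>Q. D a i N1"
        using insert by auto
      obtain a i where q: "q = (a, i)" by force
      obtain N2 where N2: "N2 \<subseteq> N1" "infinite N2" "D a i N2"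
        using dense[OF _ N1(2)] insert.prems q by blast
      show ?case
        using N1 N2 q her' by (intro exI[of _ N2]) blast
    qed
    then show ?thesis by (auto simp: E_def Q_def)
  qed
  \<comment> \<open>Stages are pairs \<open>(n, N)\<close> with \<open>E n N\<close>; passing from \<open>(n, N)\<close> to \<open>(n', N')\<close> puts
    \<open>n' - 1 \<in> N\<close> into the diagonal set.\<close>
  define P where "P j s \<longleftrightarrow> snd s \<subseteq> M \<and> infinite (snd s) \<and> E (fst s) (snd s) \<and> k \<le> fst s"
    for j :: nat and s :: "nat \<times> nat set"
  define R where "R j s s' \<longleftrightarrow> snd s' \<subseteq> snd s \<and> fst s < fst s' \<and> fst s' - 1 \<in> snd s"
    for j :: nat and s s' :: "nat \<times> nat set"
  have "\<exists>f. \<forall>j. P j (f j) \<and> R j (f j) (f (Suc j))"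
  proof (rule dependent_nat_choice)
    obtain N where "N \<subseteq> M" "infinite N" "E k N" using ex_E \<open>infinite M\<close> by blast
    then have "P 0 (k, N)" by (simp add: P_def)
    then show "\<exists>s. P 0 s" by blast
  next
    fix s j assume s: "P j s"
    then obtain n where n: "n \<in> snd s" "fst s < n"
      unfolding P_def by (meson infinite_nat_iff_unbounded)
    obtain N' where "N' \<subseteq> snd s" "infinite N'" "E (Suc n) N'"
      using ex_E s P_def by metis
    then have "P (Suc j) (Suc n, N') \<and> R j s (Suc n, N')"
      using s n unfolding P_def R_def by auto
    then show "\<exists>s'. P (Suc j) s' \<and> R j s s'" by blast
  qed
  then obtain f where f: "\<And>j. P j (f j)" "\<And>j. R j (f j) (f (Suc j))" by blast
  define n where "n j = fst (f j)" for j
  define S where "S j = snd (f j)" for j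
  have nS: "S j \<subseteq> M" "infinite (S j)" "E (n j) (S j)" "k \<le> n j" "S (Suc j) \<subseteq> S j"
      "n j < n (Suc j)" "n (Suc j) - 1 \<in> S j" for j
    using f[of j] by (auto simp: P_def R_def n_def S_def)
  have S_mono: "S j \<subseteq> S i" if "i \<le> j" for i j
    using lift_Suc_antimono_le[of S, OF nS(5) that] .
  have n_mono: "strict_mono n" using nS(6) by (simp add: strict_mono_Suc_iff)
  define h where "h j = n (Suc j) - 1" for j
  have h_mono: "strict_mono h"
    unfolding strict_mono_Suc_iff h_def
  proof
    fix j show "n (Suc j) - 1 < n (Suc (Suc j)) - 1"
      using nS(6)[of j] nS(6)[of "Suc j"] by linarith
  qed
  have h_S: "h j \<in> S i" if "i \<le> j" for i j
    using nS(7) S_mono[OF that] unfolding h_def by blast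
  define H where "H = range h"
  have "infinite H"
    unfolding H_def using h_mono by (simp add: range_inj_infinite strict_mono_imp_inj_on)
  have "D a i H" if a: "sorted_wrt (<) a" "set a \<subseteq> {..<k} \<union> H" "i \<le> length a" for a i
  proof (cases "set a \<subseteq> {..<k}")
    case True
    then have "D a i (S 0)" using nS(3)[of 0] nS(4)[of 0] a unfolding E_def by (meson lessThan_subset_iff order_trans)
    moreover have "H \<subseteq> S 0" using h_S by (auto simp: H_def)
    ultimately show ?thesis using her' \<open>infinite H\<close> by blast
  next
    case False
    \<comment> \<open>The largest entry of \<open>a\<close> was chosen at some stage, and that stage dealt with \<open>a\<close>.\<close>
    then have "a \<noteq> []" by auto
    define m where "m = Max (set a)"
    have m: "m \<in> set a" "\<And>l. l \<in> set a \<Longrightarrow> l \<le> m" using \<open>a \<noteq> []\<close> by (auto simp: m_def)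
    then have "\<not> m < k" using False by (metis lessThan_iff order_le_less_trans subsetI)
    then obtain j where j: "m = h j" using a(2) m(1) by (auto simp: H_def)
    have "set a \<subseteq> {..<n (Suc j)}" using m(2) nS(6)[of j] unfolding j h_def by fastforce
    then have "D a i (S (Suc j))" using nS(3)[of "Suc j"] a unfolding E_def by blast
    moreover have "above a H \<subseteq> S (Suc j)"
    proof
      fix l assume "l \<in> above a H"
      then obtain j' where "l = h j'" "m < l" using m(1) by (auto simp: above_def H_def)
      then have "j < j'" using h_mono j by (simp add: strict_mono_less)
      then show "l \<in> S (Suc j)" using \<open>l = h j'\<close> h_S by simp
    qed
    ultimately show ?thesis using her \<open>infinite H\<close> by blast
  qed
  moreover have "H \<subseteq> M" using h_S[of 0] nS(1)[of 0] by (auto simp: H_def)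
  ultimately show ?thesis using \<open>infinite H\<close> by blast
qed

section \<open>Open sets are completely Ramsey\<close>

text \<open>
  The basic neighbourhoods of the Ellentuck topology, with infinite sets represented by their
  increasing enumerations.
\<close>

definition ellentuck :: "nat list \<Rightarrow> nat set \<Rightarrow> (nat \<Rightarrow> nat) set" where
  "ellentuck a N = {x. strict_mono x \<and> restr x (length a) = a \<and> (\<forall>i\<ge>length a. x i \<in> N)}"

text \<open>
  Entries after the initial segment \<open>a\<close> automatically exceed those of \<open>a\<close>, so only the part of a
  set above \<open>a\<close> matters. This is what makes acceptance and rejection hereditary in the sense that
  diagonalization requires.
\<close>

lemma ellentuck_mono: "above a N' \<subseteq> N \<Longrightarrow> ellentuck a N' \<subseteq> ellentuck a N"
proof
  fix x assume "above a N' \<subseteq> N" "x \<in> ellentuck a N'"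
  moreover have "\<forall>m\<in>set a. m < x i" if "length a \<le> i" for i
  proof
    fix m assume "m \<in> set a"
    then have "m \<in> set (restr x (length a))" using \<open>x \<in> ellentuck a N'\<close> by (simp add: ellentuck_def)
    then obtain l where "m = x l" "l < length a" by (auto simp: set_restr)
    then show "m < x i"
      using that \<open>x \<in> ellentuck a N'\<close> by (simp add: ellentuck_def strict_mono_less)
  qed
  ultimately show "x \<in> ellentuck a N"
    by (auto simp: ellentuck_def above_def subset_iff)
qed

lemma ellentuck_mono': "N' \<subseteq> N \<Longrightarrow> ellentuck a N' \<subseteq> ellentuck a N"
  using ellentuck_mono above_subset by blast

lemma ellentuck_above: "ellentuck a (above a N) = ellentuck a N"
proof
  show "ellentuck a N \<subseteq> ellentuck a (above a N)"
    by (rule ellentuck_mono) simp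
qed (rule ellentuck_mono'[OF above_subset])

lemma ellentuck_restr:
  assumes "x \<in> ellentuck a N" "length a \<le> m"
  shows "x \<in> ellentuck (restr x m) N" "sorted_wrt (<) (restr x m)"
    "set (restr x m) \<subseteq> set a \<union> N" "x m \<in> above (restr x m) N"
proof -
  have x: "strict_mono x" "restr x (length a) = a" "\<And>i. length a \<le> i \<Longrightarrow> x i \<in> N"
    using assms(1) by (auto simp: ellentuck_def)
  show "x \<in> ellentuck (restr x m) N" "sorted_wrt (<) (restr x m)"
    using x assms(2) by (auto simp: ellentuck_def sorted_restr)
  have "x i \<in> set a \<union> N" for i
  proof (cases "i < length a")
    case True
    then have "x i = a ! i" using x(2) restr_eq_iff by blast
    then show ?thesis using True by simp
  qed (use x(3) in simp)
  then show "set (restr x m) \<subseteq> set a \<union> N" by (auto simp: set_restr)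
  show "x m \<in> above (restr x m) N"
    using x assms(2) by (auto simp: above_def set_restr strict_mono_less)
qed

lemma list_bounded: "\<exists>k. set a \<subseteq> {..<k}" for a :: "nat list"
  using finite_nat_iff_bounded by blast

text \<open>
  The family \<open>F\<close> codes the open set of all \<open>x\<close> with an initial segment in \<open>F\<close>. Say that \<open>N\<close>
  accepts \<open>a\<close> if every \<open>x\<close> starting with \<open>a\<close> and continuing in \<open>N\<close> enters this set, and rejects
  \<open>a\<close> if no infinite subset of \<open>N\<close> accepts \<open>a\<close>. When everything is decided, a rejected \<open>b\<close> has
  only finitely many accepted one-point extensions, because infinitely many of them would form a
  set accepting \<open>b\<close>. After a second diagonalization all one-point extensions of rejected sequences
  are rejected. So if \<open>a\<close> is rejected, then so is every further initial segment; but members of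
  \<open>F\<close> are trivially accepted, so none of them is ever met.
\<close>

lemma open_completely_ramsey:
  fixes F :: "nat list set"
  assumes "sorted_wrt (<) a" "infinite M"
  shows "\<exists>N\<subseteq>M. infinite N \<and>
    ((\<forall>x\<in>ellentuck a N. \<exists>m\<ge>length a. restr x m \<in> F) \<or>
     (\<forall>x\<in>ellentuck a N. \<forall>m\<ge>length a. restr x m \<notin> F))"
proof -
  define acc where "acc a N \<longleftrightarrow> (\<forall>x\<in>ellentuck a N. \<exists>m\<ge>length a. restr x m \<in> F)" for a N
  define rej where "rej a N \<longleftrightarrow> (\<forall>N'\<subseteq>N. infinite N' \<longrightarrow> \<not> acc a N')" for a N
  have acc_her: "acc a N'" if "acc a N" "above a N' \<subseteq> N" for a N N'
    using that ellentuck_mono unfolding acc_def by blast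
  have rej_her: "rej a N'" if "rej a N" "above a N' \<subseteq> N" for a N N'
    unfolding rej_def
  proof (intro allI impI notI)
    fix N'' assume N'': "N'' \<subseteq> N'" "infinite N''" "acc a N''"
    then have "above a N'' \<subseteq> N" using that(2) by (auto simp: above_def)
    moreover have "acc a (above a N'')" using N''(3) by (simp add: acc_def ellentuck_above)
    ultimately show False using that(1) N''(2) infinite_above unfolding rej_def by blast
  qed
  have decide: "\<exists>N\<subseteq>M. infinite N \<and> (\<forall>b. sorted_wrt (<) b \<longrightarrow> set b \<subseteq> {..<k} \<union> N \<longrightarrow> acc b N \<or> rej b N)"
    if "infinite M" for M k
  proof -
    have "\<exists>N\<subseteq>M. infinite N \<and> (\<forall>b i. sorted_wrt (<) b \<longrightarrow> set b \<subseteq> {..<k} \<union> N \<longrightarrow> i \<le> length b \<longrightarrow>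
        acc b N \<or> rej b N)"
    proof (rule diagonalization[where D = "\<lambda>b i N. acc b N \<or> rej b N"])
      show "\<exists>N'\<subseteq>N. infinite N' \<and> (acc b N' \<or> rej b N')" if "infinite N" for b and N :: "nat set"
        using that unfolding rej_def by blast
    qed (use acc_her rej_her that in blast)+
    then show ?thesis by blast
  qed
  define D where "D b i N \<longleftrightarrow> acc b N \<or> rej b N \<and> (\<forall>n\<in>above b N. rej (b @ [n]) N)"
    for b N and i :: nat
  obtain k where k: "set a \<subseteq> {..<k}" using list_bounded by blast
  have "\<exists>N\<subseteq>M. infinite N \<and> (\<forall>b i. sorted_wrt (<) b \<longrightarrow> set b \<subseteq> {..<k} \<union> N \<longrightarrow> i \<le> length b \<longrightarrow> D b i N)"
  proof (rule diagonalization)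
    fix b :: "nat list" and i N N' assume D: "D b i N" and "infinite N'" and N': "above b N' \<subseteq> N"
    have "above b N' \<subseteq> above b N" using N' by (auto simp: above_def)
    moreover have "above (b @ [n]) N' \<subseteq> N" for n using N' by (auto simp: above_def)
    ultimately show "D b i N'" using D acc_her rej_her N' unfolding D_def by blast
  next
    fix b :: "nat list" and i and N :: "nat set" assume b: "sorted_wrt (<) b" and N: "infinite N"
    show "\<exists>N'\<subseteq>N. infinite N' \<and> D b i N'"
    proof (cases "rej b N")
      case False
      then show ?thesis unfolding rej_def D_def by blast
    next
      case True
      obtain k where k: "set b \<subseteq> {..<k}" using list_bounded by blast
      obtain N1 where N1: "N1 \<subseteq> N" "infinite N1"
          "\<And>b. sorted_wrt (<) b \<Longrightarrow> set b \<subseteq> {..<k} \<union> N1 \<Longrightarrow> acc b N1 \<or> rej b N1"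
        using decide[OF N, of k] by blast
      define S where "S = {n \<in> above b N1. acc (b @ [n]) N1}"
      have "S \<subseteq> N1" by (auto simp: S_def above_def)
      have "acc b S"
        unfolding acc_def
      proof
        fix x assume x: "x \<in> ellentuck b S"
        then have "x (length b) \<in> S" "restr x (Suc (length b)) = b @ [x (length b)]"
          by (auto simp: ellentuck_def restr_Suc)
        moreover have "x \<in> ellentuck (restr x (Suc (length b))) N1"
          using ellentuck_restr(1)[OF x, of "Suc (length b)"] ellentuck_mono'[OF \<open>S \<subseteq> N1\<close>] by auto
        ultimately have "\<exists>m\<ge>length (b @ [x (length b)]). restr x m \<in> F"
          unfolding S_def acc_def by auto
        then show "\<exists>m\<ge>length b. restr x m \<in> F" by (auto intro: Suc_leD)
      qed
      then have "finite S" using True \<open>S \<subseteq> N1\<close> N1(1) unfolding rej_def by blast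
      define N2 where "N2 = above b N1 - S"
      have "infinite N2" using \<open>finite S\<close> infinite_above[OF N1(2)] by (simp add: N2_def Diff_infinite_finite)
      have "N2 \<subseteq> N1" by (auto simp: N2_def above_def)
      have "rej (b @ [n]) N2" if "n \<in> above b N2" for n
      proof -
        have "n \<in> N1" "n \<notin> S" "\<forall>m\<in>set b. m < n" "n \<in> above b N1"
          using that by (auto simp: above_def N2_def)
        moreover have "sorted_wrt (<) (b @ [n])" "set (b @ [n]) \<subseteq> {..<k} \<union> N1"
          using b k calculation by (auto simp: sorted_wrt_append)
        ultimately have "rej (b @ [n]) N1" using N1(3) unfolding S_def by blast
        then show ?thesis using rej_her \<open>N2 \<subseteq> N1\<close> above_subset by blast
      qed
      moreover have "rej b N2" using rej_her[OF True] \<open>N2 \<subseteq> N1\<close> N1(1) above_subset by blast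
      ultimately show ?thesis
        using \<open>infinite N2\<close> \<open>N2 \<subseteq> N1\<close> N1(1) unfolding D_def by blast
    qed
  qed (rule assms(2))
  then obtain N where N: "N \<subseteq> M" "infinite N"
      "\<And>b. sorted_wrt (<) b \<Longrightarrow> set b \<subseteq> {..<k} \<union> N \<Longrightarrow> D b 0 N"
    by blast
  show ?thesis
  proof (cases "acc a N")
    case True
    then show ?thesis using N unfolding acc_def by blast
  next
    case False
    then have "rej a N" using N(3)[OF assms(1)] k unfolding D_def by blast
    have "restr x m \<notin> F" if x: "x \<in> ellentuck a N" and m: "length a \<le> m" for x m
    proof -
      have "rej (restr x m) N"
        using m
      proof (induction rule: dec_induct)
        case base
        then show ?case using \<open>rej a N\<close> x by (simp add: ellentuck_def)
      next
        case (step m)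
        then have "\<not> acc (restr x m) N" using N(2) unfolding rej_def by blast
        moreover have "D (restr x m) 0 N"
          using ellentuck_restr[OF x \<open>length a \<le> m\<close>] k by (intro N(3)) auto
        ultimately show ?case
          using ellentuck_restr(4)[OF x \<open>length a \<le> m\<close>] unfolding D_def by (auto simp: restr_Suc)
      qed
      then have "\<not> acc (restr x m) N" using N(2) unfolding rej_def by blast
      then show ?thesis
        unfolding acc_def by (auto simp: ellentuck_def)
    qed
    then show ?thesis using N by blast
  qed
qed

section \<open>Analytic sets are Ramsey\<close>

text \<open>
  The argument with accepted and rejected pairs \<open>(a, t)\<close>. The requirement \<open>D\<close> says that a pair is
  accepted, or else rejected and, along every \<open>x\<close>, prolonged by a rejected pair with a strictly
  longer first component and one more entry in the second. To see that it can be achieved, apply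
  the Ramsey property to the open set of all \<open>x\<close> along which such a prolongation exists. If it
  were avoided, take \<open>(x, y) \<in> C\<close> extending \<open>(a, t)\<close>, which exists by rejection: a sufficiently
  long initial segment of \<open>x\<close>, together with the next value of \<open>y\<close>, forms a pair that is not
  rejected, hence accepted, which \<open>(x, y)\<close> contradicts. The sequences \<open>t\<close> are numbered by
  \<open>list_encode\<close>, so that the empty sequence has code \<open>0\<close> and is treated from the start.
\<close>

lemma projection_of_closed_ramsey:
  fixes C :: "((nat \<Rightarrow> nat) \<times> (nat \<Rightarrow> nat)) set"
  assumes "closed C"
  shows "\<exists>H. infinite H \<and>
    ((\<forall>x. strict_mono x \<longrightarrow> range x \<subseteq> H \<longrightarrow> (\<exists>y. (x, y) \<in> C)) \<or>
     (\<forall>x. strict_mono x \<longrightarrow> range x \<subseteq> H \<longrightarrow> (\<nexists>y. (x, y) \<in> C)))"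
proof -
  define acc where "acc a t N \<longleftrightarrow> (\<forall>(x,y)\<in>C. x \<in> ellentuck a N \<longrightarrow> restr y (length t) \<noteq> t)" for a t N
  define rej where "rej a t N \<longleftrightarrow> (\<forall>N'\<subseteq>N. infinite N' \<longrightarrow> \<not> acc a t N')" for a t N
  have acc_her: "acc a t N'" if "acc a t N" "above a N' \<subseteq> N" for a t N N'
    using that ellentuck_mono unfolding acc_def by blast
  have rej_her: "rej a t N'" if "rej a t N" "above a N' \<subseteq> N" for a t N N'
    unfolding rej_def
  proof (intro allI impI notI)
    fix N'' assume N'': "N'' \<subseteq> N'" "infinite N''" "acc a t N''"
    then have "above a N'' \<subseteq> N" using that(2) by (auto simp: above_def)
    moreover have "acc a t (above a N'')" using N''(3) by (simp add: acc_def ellentuck_above)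
    ultimately show False using that(1) N''(2) infinite_above unfolding rej_def by blast
  qed
  have decide: "\<exists>N\<subseteq>M. infinite N \<and> (\<forall>b t. sorted_wrt (<) b \<longrightarrow> set b \<subseteq> {..<k} \<union> N \<longrightarrow>
      list_encode t \<le> length b \<longrightarrow> acc b t N \<or> rej b t N)"
    if "infinite M" for M k
  proof -
    have "\<exists>N\<subseteq>M. infinite N \<and> (\<forall>b i. sorted_wrt (<) b \<longrightarrow> set b \<subseteq> {..<k} \<union> N \<longrightarrow> i \<le> length b \<longrightarrow>
        acc b (list_decode i) N \<or> rej b (list_decode i) N)"
    proof (rule diagonalization[where D = "\<lambda>b i N. acc b (list_decode i) N \<or> rej b (list_decode i) N"])
      show "\<exists>N'\<subseteq>N. infinite N' \<and> (acc b (list_decode i) N' \<or> rej b (list_decode i) N')"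
        if "infinite N" for b i and N :: "nat set"
        using that unfolding rej_def by blast
    qed (use acc_her rej_her that in blast)+
    then show ?thesis by (metis list_encode_inverse)
  qed
  define D where "D a i N \<longleftrightarrow> acc a (list_decode i) N \<or> rej a (list_decode i) N \<and>
      (\<forall>x\<in>ellentuck a N. \<exists>m n. length a < m \<and> list_encode (list_decode i @ [n]) \<le> m \<and>
         rej (restr x m) (list_decode i @ [n]) N)" for a i N
  have "\<exists>N\<subseteq>UNIV. infinite N \<and> (\<forall>a i. sorted_wrt (<) a \<longrightarrow> set a \<subseteq> {..<0} \<union> N \<longrightarrow> i \<le> length a \<longrightarrow> D a i N)"
  proof (rule diagonalization)
    fix a :: "nat list" and i N N' assume D: "D a i N" and "infinite N'" and N': "above a N' \<subseteq> N"
    have rej': "rej (restr x m) t N'"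
      if x: "x \<in> ellentuck a N'" "length a < m" and "rej (restr x m) t N" for x m t
    proof (rule rej_her[OF that(3)])
      have "set a \<subseteq> set (restr x m)"
      proof -
        have "restr x (length a) = a" using x(1) by (simp add: ellentuck_def)
        then have "prefix a (restr x m)" using prefix_restr[of "length a" m x] x(2) by simp
        then show ?thesis by (rule set_mono_prefix)
      qed
      then show "above (restr x m) N' \<subseteq> N" using N' by (auto simp: above_def)
    qed
    show "D a i N'"
    proof (cases "acc a (list_decode i) N")
      case True
      then show ?thesis using acc_her[OF _ N'] unfolding D_def by simp
    next
      case False
      then have r: "rej a (list_decode i) N" and s: "\<And>x. x \<in> ellentuck a N \<Longrightarrow>
          \<exists>m n. length a < m \<and> list_encode (list_decode i @ [n]) \<le> m \<and>
            rej (restr x m) (list_decode i @ [n]) N"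
        using D unfolding D_def by simp_all
      have "\<exists>m n. length a < m \<and> list_encode (list_decode i @ [n]) \<le> m \<and>
            rej (restr x m) (list_decode i @ [n]) N'" if x: "x \<in> ellentuck a N'" for x
        using s[of x] ellentuck_mono[OF N'] rej'[OF x] x by (meson subsetD)
      then show ?thesis using rej_her[OF r N'] unfolding D_def by simp
    qed
  next
    fix a :: "nat list" and i and N :: "nat set" assume a: "sorted_wrt (<) a" and N: "infinite N"
    define t where "t = list_decode i"
    show "\<exists>N'\<subseteq>N. infinite N' \<and> D a i N'"
    proof (cases "rej a t N")
      case False
      then show ?thesis unfolding rej_def D_def t_def by blast
    next
      case True
      obtain k where k: "set a \<subseteq> {..<k}" using list_bounded by blast
      obtain N1 where N1: "N1 \<subseteq> N" "infinite N1"
          "\<And>b t. sorted_wrt (<) b \<Longrightarrow> set b \<subseteq> {..<k} \<union> N1 \<Longrightarrow> list_encode t \<le> length b \<Longrightarrow>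
             acc b t N1 \<or> rej b t N1"
        using decide[OF N, of k] by blast
      define F where "F = {b. length a < length b \<and>
          (\<exists>n. list_encode (t @ [n]) \<le> length b \<and> rej b (t @ [n]) N1)}"
      obtain N2 where N2: "N2 \<subseteq> N1" "infinite N2" and ram:
          "(\<forall>x\<in>ellentuck a N2. \<exists>m\<ge>length a. restr x m \<in> F) \<or>
           (\<forall>x\<in>ellentuck a N2. \<forall>m\<ge>length a. restr x m \<notin> F)"
        using open_completely_ramsey[OF a N1(2)] by blast
      have "rej a t N2" using rej_her[OF True] N2 N1 above_subset by blast
      have "\<exists>m n. length a < m \<and> list_encode (t @ [n]) \<le> m \<and> rej (restr x m) (t @ [n]) N2"
        if x: "x \<in> ellentuck a N2" for x
        using ram
      proof
        assume "\<forall>x\<in>ellentuck a N2. \<exists>m\<ge>length a. restr x m \<in> F"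
        then obtain m where "restr x m \<in> F" using x by blast
        then obtain n where "length a < m" "list_encode (t @ [n]) \<le> m"
            "rej (restr x m) (t @ [n]) N1"
          by (auto simp: F_def)
        moreover have "above (restr x m) N2 \<subseteq> N1" using N2(1) above_subset by blast
        ultimately show ?thesis using rej_her by blast
      next
        assume none: "\<forall>x\<in>ellentuck a N2. \<forall>m\<ge>length a. restr x m \<notin> F"
        obtain x y where xy: "(x, y) \<in> C" "x \<in> ellentuck a N2" "restr y (length t) = t"
          using \<open>rej a t N2\<close> N2(2) unfolding rej_def acc_def by blast
        define n where "n = y (length t)"
        \<comment> \<open>Long enough to prolong \<open>a\<close> properly and for \<open>N1\<close> to decide the pair.\<close>
        define m where "m = max (Suc (length a)) (list_encode (t @ [n]))"
        have m: "length a \<le> m" "length a < m" "list_encode (t @ [n]) \<le> m" by (auto simp: m_def)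
        have "\<not> rej (restr x m) (t @ [n]) N1"
          using none[rule_format, OF xy(2) m(1)] m(2,3) unfolding F_def by auto
        moreover have "x \<in> ellentuck a N1" using xy(2) ellentuck_mono'[OF N2(1)] by blast
        note x = ellentuck_restr[OF this m(1)]
        ultimately have "acc (restr x m) (t @ [n]) N1"
          using N1(3)[of "restr x m" "t @ [n]"] k m by auto
        moreover have "restr y (length (t @ [n])) = t @ [n]"
          using xy(3) by (simp add: restr_Suc n_def)
        ultimately have False using x(1) xy(1) unfolding acc_def by blast
        then show ?thesis ..
      qed
      then have "D a i N2" using \<open>rej a t N2\<close> unfolding D_def t_def by blast
      then show ?thesis using N2 N1 by blast
    qed
  qed simp
  then obtain H where H: "infinite H"
      "\<And>a i. sorted_wrt (<) a \<Longrightarrow> set a \<subseteq> H \<Longrightarrow> i \<le> length a \<Longrightarrow> D a i H"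
    by auto
  have el: "x \<in> ellentuck [] H" if "strict_mono x" "range x \<subseteq> H" for x
    using that by (auto simp: ellentuck_def)
  show ?thesis
  proof (cases "rej [] [] H")
    case False
    moreover have "D [] 0 H" by (rule H) auto
    ultimately have "acc [] [] H" unfolding D_def by auto
    then have "\<nexists>y. (x, y) \<in> C" if "strict_mono x" "range x \<subseteq> H" for x
      using el[OF that] unfolding acc_def by auto
    then show ?thesis using H(1) by blast
  next
    case True
    have "\<exists>y. (x, y) \<in> C" if x: "strict_mono x" "range x \<subseteq> H" for x
    proof -
      \<comment> \<open>Walk along \<open>x\<close>, extending the rejected pair by one value of \<open>y\<close> at a time.\<close>
      define P where "P j s \<longleftrightarrow> rej (restr x (fst s)) (snd s) H \<and> j \<le> fst s \<and>
          list_encode (snd s) \<le> fst s \<and> length (snd s) = j" for j and s :: "nat \<times> nat list"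
      define R where "R j s s' \<longleftrightarrow> (\<exists>n. snd s' = snd s @ [n])" for j :: nat and s s' :: "nat \<times> nat list"
      have "\<exists>f. \<forall>j. P j (f j) \<and> R j (f j) (f (Suc j))"
      proof (rule dependent_nat_choice)
        show "\<exists>s. P 0 s" using True by (intro exI[of _ "(0, [])"]) (simp add: P_def)
      next
        fix s j assume s: "P j s"
        define m where "m = fst s"
        note xm = ellentuck_restr[OF el[OF x], of m]
        have "D (restr x m) (list_encode (snd s)) H"
          using s xm by (intro H) (auto simp: P_def m_def)
        moreover have "\<not> acc (restr x m) (snd s) H"
          using s H(1) unfolding P_def rej_def m_def by blast
        ultimately obtain m' n where "m < m'" "list_encode (snd s @ [n]) \<le> m'"
            "rej (restr x m') (snd s @ [n]) H"
          using xm(1) unfolding D_def by auto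
        then have "P (Suc j) (m', snd s @ [n]) \<and> R j s (m', snd s @ [n])"
          using s unfolding P_def R_def m_def by auto
        then show "\<exists>s'. P (Suc j) s' \<and> R j s s'" by blast
      qed
      then obtain f where f: "\<And>j. P j (f j)" "\<And>j. R j (f j) (f (Suc j))" by blast
      define y where "y j = snd (f (Suc j)) ! j" for j
      have y: "snd (f j) = restr y j" for j
      proof (induction j)
        case 0
        then show ?case using f(1)[of 0] by (simp add: P_def)
      next
        case (Suc j)
        obtain n where n: "snd (f (Suc j)) = restr y j @ [n]"
          using f(2)[of j] Suc by (auto simp: R_def)
        then have "y j = n" by (simp add: y_def nth_append)
        then show ?case using n by (simp add: restr_Suc)
      qed
      have "(x, y) \<in> C"
      proof (rule closed_limit_point[OF assms])
        fix k
        define m where "m = fst (f k)"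
        have "rej (restr x m) (restr y k) H" "k \<le> m"
          using f(1)[of k] y by (auto simp: P_def m_def)
        then have "\<not> acc (restr x m) (restr y k) H" using H(1) unfolding rej_def by blast
        then obtain x' y' where "(x', y') \<in> C" "x' \<in> ellentuck (restr x m) H" "restr y' k = restr y k"
          unfolding acc_def by auto
        moreover from this have "restr x' k = restr x k"
          using \<open>k \<le> m\<close> by (metis (mono_tags, lifting) ellentuck_def length_restr mem_Collect_eq take_restr)
        ultimately show "\<exists>x' y'. (x', y') \<in> C \<and> restr x' k = restr x k \<and> restr y' k = restr y k"
          by blast
      qed
      then show ?thesis by blast
    qed
    then show ?thesis using H(1) by blast
  qed
qed

theorem analytic_ramsey:
  fixes A :: "(nat \<Rightarrow> 'b::t2_space) set" and \<phi> :: "(nat \<Rightarrow> nat) \<Rightarrow> nat \<Rightarrow> 'b"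
  assumes "analytic_set A" and \<phi>: "continuous_on UNIV \<phi>"
  shows "\<exists>H. infinite H \<and>
    (\<phi> ` {x. strict_mono x \<and> range x \<subseteq> H} \<subseteq> A \<or> \<phi> ` {x. strict_mono x \<and> range x \<subseteq> H} \<inter> A = {})"
proof (cases "A = {}")
  case True
  then show ?thesis by auto
next
  case False
  then obtain f :: "(nat \<Rightarrow> nat) \<Rightarrow> nat \<Rightarrow> 'b" where f: "continuous_on UNIV f" "A = range f"
    using assms(1) unfolding analytic_set_def by blast
  define C where "C = {p. \<phi> (fst p) = f (snd p)}"
  have "C = (\<Inter>k. {p. \<phi> (fst p) k = f (snd p) k})"
    by (auto simp: C_def fun_eq_iff)
  moreover have "closed {p. \<phi> (fst p) k = f (snd p) k}" for k
  proof (rule closed_Collect_eq)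
    show "continuous_on UNIV (\<lambda>p. \<phi> (fst p) k)"
      by (rule continuous_on_compose2[OF continuous_on_product_then_coordinatewise[OF \<phi>]])
         (auto intro: continuous_intros)
    show "continuous_on UNIV (\<lambda>p. f (snd p) k)"
      by (rule continuous_on_compose2[OF continuous_on_product_then_coordinatewise[OF f(1)]])
         (auto intro: continuous_intros)
  qed
  ultimately have "closed C" by auto
  from projection_of_closed_ramsey[OF this] show ?thesis
  proof (elim exE conjE disjE)
    fix H :: "nat set"
    assume "infinite H" and H: "\<forall>x. strict_mono x \<longrightarrow> range x \<subseteq> H \<longrightarrow> (\<exists>y. (x, y) \<in> C)"
    have "\<phi> ` {x. strict_mono x \<and> range x \<subseteq> H} \<subseteq> A" using H by (auto simp: C_def f(2))
    then show ?thesis using \<open>infinite H\<close> by blast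
  next
    fix H :: "nat set"
    assume "infinite H" and H: "\<forall>x. strict_mono x \<longrightarrow> range x \<subseteq> H \<longrightarrow> (\<nexists>y. (x, y) \<in> C)"
    have "\<phi> ` {x. strict_mono x \<and> range x \<subseteq> H} \<inter> A = {}" using H by (fastforce simp: C_def f(2))
    then show ?thesis using \<open>infinite H\<close> by blast
  qed
qed

text \<open>
  The common reduction: after the Ramsey theorem has found \<open>H\<close>, a condition whose body consists of
  images of increasing sequences in \<open>H\<close> is homogeneous for \<open>A\<close>.
\<close>

lemma forcing_measurableI:
  fixes A :: "(nat \<Rightarrow> 'b::t2_space) set"
  assumes "analytic_set A"
    and "\<And>p. p \<in> P \<Longrightarrow> \<exists>\<phi> :: (nat \<Rightarrow> nat) \<Rightarrow> nat \<Rightarrow> 'b. continuous_on UNIV \<phi> \<and>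
      (\<forall>H. infinite H \<longrightarrow> (\<exists>p'\<in>P. le p' p \<and> body p' \<subseteq> \<phi> ` {x. strict_mono x \<and> range x \<subseteq> H}))"
  shows "forcing_measurable P le body A"
  unfolding forcing_measurable_def
proof
  fix p assume "p \<in> P"
  then obtain \<phi> :: "(nat \<Rightarrow> nat) \<Rightarrow> nat \<Rightarrow> 'b" where \<phi>: "continuous_on UNIV \<phi>"
      "\<forall>H. infinite H \<longrightarrow> (\<exists>p'\<in>P. le p' p \<and> body p' \<subseteq> \<phi> ` {x. strict_mono x \<and> range x \<subseteq> H})"
    using assms(2)[OF \<open>p \<in> P\<close>] by (elim exE conjE) (erule (1) that)
  obtain H where H: "infinite H" "\<phi> ` {x. strict_mono x \<and> range x \<subseteq> H} \<subseteq> A \<or>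
      \<phi> ` {x. strict_mono x \<and> range x \<subseteq> H} \<inter> A = {}"
    using analytic_ramsey[OF assms(1) \<phi>(1)] by blast
  obtain p' where "p' \<in> P" "le p' p" "body p' \<subseteq> \<phi> ` {x. strict_mono x \<and> range x \<subseteq> H}"
    using \<phi>(2) H(1) by auto
  then show "\<exists>p'\<in>P. le p' p \<and> (body p' \<inter> A = {} \<or> body p' \<subseteq> A)"
    using H(2) by (intro bexI[of _ p']) blast+
qed

section \<open>Copies of trees of sequences inside other trees\<close>

text \<open>
  An embedding of finite sequences into a tree. From the node \<open>e u\<close> the extensions of \<open>u\<close> branch
  off immediately, in distinct directions \<open>c u n\<close>, although \<open>e (u @ [n])\<close> itself may lie much
  higher.
\<close>

locale tree_copy =
  fixes e :: "'a list \<Rightarrow> 'b list" and c :: "'a list \<Rightarrow> 'a \<Rightarrow> 'b"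
  assumes e_step: "prefix (e u @ [c u n]) (e (u @ [n]))"
    and c_inj: "c u m = c u n \<Longrightarrow> m = n"
begin

definition copy :: "'a list set \<Rightarrow> 'b list set" where
  "copy U = {t. \<exists>u\<in>U. prefix t (e u)}"

definition limit :: "(nat \<Rightarrow> 'a) \<Rightarrow> nat \<Rightarrow> 'b" where
  "limit x k = e (restr x (Suc k)) ! k"

lemma e_mono: "prefix u v \<Longrightarrow> prefix (e u) (e v)"
proof -
  have "prefix (e u) (e (u @ w))" for w
  proof (induction w rule: rev_induct)
    case (snoc n w)
    then show ?case using e_step[of "u @ w" n]
      by (metis append.assoc append_prefixD prefix_order.trans)
  qed simp
  then show "prefix u v \<Longrightarrow> prefix (e u) (e v)" by (auto simp: prefix_def)
qed

lemma e_mono_step: "prefix (u @ [n]) v \<Longrightarrow> prefix (e u @ [c u n]) (e v)"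
  using e_step e_mono prefix_order.trans by blast

lemma length_e: "length u \<le> length (e u)"
proof (induction u rule: rev_induct)
  case (snoc n u)
  then show ?case using prefix_length_le[OF e_step[of u n]] by simp
qed simp

text \<open>
  Incomparable sequences have images that branch off at the image of their longest common initial
  segment; so \<open>e\<close> reflects the order, and the branching of the copy takes place at the nodes \<open>e w\<close>
  only.
\<close>

lemma e_parallel:
  assumes "u \<parallel> v"
  obtains w m n where "m \<noteq> n" "prefix (w @ [m]) u" "prefix (w @ [n]) v"
    "prefix (e w @ [c w m]) (e u)" "prefix (e w @ [c w n]) (e v)" "c w m \<noteq> c w n"
proof -
  obtain w m us n vs where "m \<noteq> n" "u = w @ m # us" "v = w @ n # vs"
    using parallel_decomp[OF assms] by blast
  then have "m \<noteq> n" "prefix (w @ [m]) u" "prefix (w @ [n]) v" by auto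
  then show thesis using that e_mono_step c_inj by blast
qed

lemma e_step_unique:
  assumes "prefix (e u @ [b]) (e v)"
  shows "\<exists>n. b = c u n \<and> prefix (u @ [n]) v"
proof -
  have uv: "prefix (e u) (e v)" using assms append_prefixD by blast
  have "\<not> u \<parallel> v"
  proof
    assume "u \<parallel> v"
    then obtain w m n where w: "prefix (e w @ [c w m]) (e u)" "prefix (e w @ [c w n]) (e v)"
        "c w m \<noteq> c w n"
      using e_parallel by metis
    then have "prefix (e w @ [c w m]) (e v)" using uv prefix_order.trans by blast
    then show False using w(2,3) by (auto simp: prefix_def)
  qed
  moreover have "\<not> prefix v u"
  proof
    assume "prefix v u"
    then have "prefix (e u @ [b]) (e u)" using e_mono assms prefix_order.trans by blast
    then show False using prefix_length_le by fastforce
  qed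
  ultimately have "strict_prefix u v" by (auto simp: parallel_def strict_prefix_def)
  then obtain n where n: "prefix (u @ [n]) v"
    by (metis append_Cons append_Nil append_assoc prefixI strict_prefixE')
  then have "prefix (e u @ [c u n]) (e v)" by (rule e_mono_step)
  then have "b = c u n" using assms by (auto simp: prefix_def)
  then show ?thesis using n by blast
qed

lemma is_tree_copy:
  assumes "is_tree U"
  shows "is_tree (copy U)"
  unfolding is_tree_def
proof (intro conjI ballI allI impI)
  show "copy U \<noteq> {}" using assms by (auto simp: is_tree_def copy_def)
  show "s \<in> copy U" if "t \<in> copy U" "prefix s t" for s t
    using that prefix_order.trans by (auto simp: copy_def)
qed

lemma e_in_copy: "u \<in> U \<Longrightarrow> e u \<in> copy U"
  by (auto simp: copy_def)

lemma imm_succs_copy: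
  assumes "is_tree U" "u \<in> U"
  shows "imm_succs (copy U) (e u) = (\<lambda>n. e u @ [c u n]) ` {n. u @ [n] \<in> U}"
proof
  show "imm_succs (copy U) (e u) \<subseteq> (\<lambda>n. e u @ [c u n]) ` {n. u @ [n] \<in> U}"
  proof
    fix t assume "t \<in> imm_succs (copy U) (e u)"
    then obtain b v where t: "t = e u @ [b]" "v \<in> U" "prefix (e u @ [b]) (e v)"
      by (auto simp: imm_succs_def copy_def)
    then obtain n where "b = c u n" "prefix (u @ [n]) v" using e_step_unique by blast
    then show "t \<in> (\<lambda>n. e u @ [c u n]) ` {n. u @ [n] \<in> U}"
      using t assms(1) unfolding is_tree_def by blast
  qed
  show "(\<lambda>n. e u @ [c u n]) ` {n. u @ [n] \<in> U} \<subseteq> imm_succs (copy U) (e u)"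
    using e_step by (auto simp: imm_succs_def copy_def)
qed

lemma splitting_node_copyD:
  assumes "is_tree U" "splitting_node (copy U) t"
  shows "\<exists>u\<in>U. t = e u"
proof -
  obtain i j u v where ij: "i \<noteq> j" and uv: "u \<in> U" "v \<in> U"
    "prefix (t @ [i]) (e u)" "prefix (t @ [j]) (e v)"
    using assms(2) by (auto simp: splitting_node_def imm_succs_def copy_def)
  have "\<not> prefix (e u) (e v)" "\<not> prefix (e v) (e u)"
    using ij uv(3,4) by (auto simp: prefix_def)
  then have "u \<parallel> v" using e_mono by (auto simp: parallel_def)
  then obtain w m n where w: "prefix (w @ [m]) u" "prefix (e w @ [c w m]) (e u)"
      "prefix (e w @ [c w n]) (e v)" "c w m \<noteq> c w n"
    using e_parallel by metis
  \<comment> \<open>Both \<open>t\<close> and \<open>e w\<close> are the longest common initial segment of \<open>e u\<close> and \<open>e v\<close>.\<close>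
  have "t = e w"
  proof (cases "length t" "length (e w)" rule: linorder_cases)
    case less
    then have "prefix (t @ [i]) (e w)" "prefix (t @ [j]) (e w)"
      using uv(3,4) w(2,3) append_prefixD
      by (metis Suc_leI length_append_singleton prefix_length_prefix)+
    then show ?thesis using ij by (auto simp: prefix_def)
  next
    case greater
    then have "prefix (e w @ [c w m]) t" "prefix (e w @ [c w n]) t"
      using uv(3,4) w(2,3) append_prefixD
      by (metis Suc_leI length_append_singleton prefix_length_prefix)+
    then show ?thesis using w(4) by (auto simp: prefix_def)
  next
    case equal
    then show ?thesis using uv(3) w(2)
      by (metis append_eq_append_conv append_prefixD order_refl prefixE prefix_length_prefix)
  qed
  moreover have "w \<in> U" using w(1) uv(1) assms(1) append_prefixD unfolding is_tree_def by blast
  ultimately show ?thesis by blast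
qed

text \<open>
  The nodes \<open>e (restr x n)\<close> form a chain, and since they have length at least \<open>n\<close>, the diagonal
  formula for \<open>limit x\<close> reads off their union.
\<close>

lemma restr_limit: "restr (limit x) (length (e (restr x n))) = e (restr x n)"
  unfolding restr_eq_iff
proof (intro allI impI)
  fix k assume k: "k < length (e (restr x n))"
  have k': "k < length (e (restr x (Suc k)))"
    using length_e[of "restr x (Suc k)"] by simp
  have "prefix (e (restr x n)) (e (restr x (Suc k))) \<or> prefix (e (restr x (Suc k))) (e (restr x n))"
    using prefix_restr[THEN e_mono] nat_le_linear by blast
  then show "limit x k = e (restr x n) ! k"
    unfolding limit_def using k k' by (auto simp: prefix_def nth_append)
qed

text \<open>
  A branch \<open>z\<close> of the copy passes through \<open>e []\<close>, and whenever it passes through \<open>e u\<close>, its next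
  value is a direction \<open>c u n\<close> that determines \<open>n\<close>; from there on it must follow \<open>e (u @ [n])\<close>,
  since the copy does not branch in between. Iterating recovers the sequence whose limit is \<open>z\<close>.
\<close>

lemma branches_copy:
  assumes U: "is_tree U"
  shows "branches (copy U) \<subseteq> limit ` branches U"
proof
  fix z assume z: "z \<in> branches (copy U)"
  define good where "good u \<longleftrightarrow> u \<in> U \<and> restr z (length (e u)) = e u" for u
  have in_copy: "\<exists>v\<in>U. prefix (restr z n) (e v)" for n
    using z by (auto simp: branches_def copy_def)
  have "[] \<in> U" using U unfolding is_tree_def by auto
  have "good []"
  proof -
    obtain v where "prefix (restr z (length (e []))) (e v)" using in_copy by blast
    moreover have "prefix (e []) (e v)" by (rule e_mono) simp
    ultimately have "restr z (length (e [])) = e []"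
      by (metis length_restr append_eq_append_conv prefixE)
    then show ?thesis using \<open>[] \<in> U\<close> by (simp add: good_def)
  qed
  have good_step: "\<exists>n. good (u @ [n])" if "good u" for u
  proof -
    define l where "l = length (e u)"
    have zl: "restr z (Suc l) = e u @ [z l]" using that by (simp add: restr_Suc good_def l_def)
    obtain v where v: "v \<in> U" "prefix (e u @ [z l]) (e v)" using in_copy[of "Suc l"] zl by auto
    then obtain n where n: "z l = c u n" "prefix (u @ [n]) v" using e_step_unique by blast
    define l' where "l' = length (e (u @ [n]))"
    have "Suc l \<le> l'" using prefix_length_le[OF e_step[of u n]] by (simp add: l_def l'_def)
    obtain v' where v': "prefix (restr z l') (e v')" using in_copy by blast
    have "prefix (e u @ [c u n]) (e v')"
      using v' prefix_restr[OF \<open>Suc l \<le> l'\<close>, of z] zl n(1) prefix_order.trans by metis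
    then obtain n' where "c u n = c u n'" "prefix (u @ [n']) v'" using e_step_unique by blast
    then have "prefix (u @ [n]) v'" using c_inj by blast
    then have "restr z l' = e (u @ [n])"
      using v' e_mono unfolding l'_def by (metis length_restr append_eq_append_conv prefixE)
    moreover have "u @ [n] \<in> U" using n(2) v(1) U unfolding is_tree_def by blast
    ultimately show ?thesis unfolding good_def l'_def by blast
  qed
  then obtain nx where nx: "\<And>u. good u \<Longrightarrow> good (u @ [nx u])" by metis
  define x where "x k = nx (((\<lambda>u. u @ [nx u]) ^^ k) [])" for k
  have x: "((\<lambda>u. u @ [nx u]) ^^ k) [] = restr x k" for k
    by (induction k) (simp_all add: restr_Suc x_def)
  have good_x: "good (restr x k)" for k
  proof (induction k)
    case (Suc k)
    have "x k = nx (restr x k)" using x_def x by simp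
    then show ?case using nx[OF Suc] by (simp add: restr_Suc)
  qed (simp add: \<open>good []\<close>)
  have "z k = limit x k" for k
  proof -
    have "k < length (e (restr x (Suc k)))" using length_e[of "restr x (Suc k)"] by simp
    then show ?thesis using good_x[of "Suc k"] restr_limit[of x "Suc k"]
      unfolding good_def by (metis nth_restr)
  qed
  then have "z = limit x" by blast
  moreover have "x \<in> branches U" using good_x by (simp add: branches_def good_def)
  ultimately show "z \<in> limit ` branches U" by blast
qed

lemma limit_cong: "restr x (Suc k) = restr y (Suc k) \<Longrightarrow> limit x k = limit y k"
  by (simp add: limit_def)

end

text \<open>
  How embeddings are obtained: \<open>G\<close> is a set of nodes at which the tree splits, \<open>d\<close> numbers
  directions out of them, and \<open>g t n\<close> is a node of \<open>G\<close> reached in direction \<open>d t n\<close>.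
\<close>

lemma tree_copy_foldl:
  fixes T :: "'b list set" and d :: "'b list \<Rightarrow> 'a \<Rightarrow> 'b"
  assumes T: "is_tree T" and G: "G \<subseteq> T" "s \<in> G"
    and step: "\<And>t n. t \<in> G \<Longrightarrow> g t n \<in> G \<and> prefix (t @ [d t n]) (g t n)"
    and inj: "\<And>t m n. t \<in> G \<Longrightarrow> d t m = d t n \<Longrightarrow> m = n"
  shows "foldl g s u \<in> G" "tree_copy (foldl g s) (\<lambda>u. d (foldl g s u))"
    "tree_copy.copy (foldl g s) U \<subseteq> T"
proof -
  show in_G: "foldl g s u \<in> G" for u
    by (induction u rule: rev_induct) (use step G(2) in auto)
  show "tree_copy (foldl g s) (\<lambda>u. d (foldl g s u))"
    by unfold_locales (use step in_G in simp, use inj[OF in_G] in blast)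
  then interpret tree_copy "foldl g s" "\<lambda>u. d (foldl g s u)" .
  show "copy U \<subseteq> T"
    using T G(1) in_G unfolding copy_def is_tree_def by blast
qed

section \<open>Laver and Miller forcing\<close>

definition increasing_tree :: "nat set \<Rightarrow> nat list set" where
  "increasing_tree H = {u. sorted_wrt (<) u \<and> set u \<subseteq> H}"

lemma is_tree_increasing: "is_tree (increasing_tree H)"
  unfolding is_tree_def increasing_tree_def
  by (auto simp: prefix_def sorted_wrt_append intro: exI[of _ "[]"])

lemma branches_increasing: "branches (increasing_tree H) = {x. strict_mono x \<and> range x \<subseteq> H}"
proof (intro set_eqI iffI)
  fix x assume x: "x \<in> branches (increasing_tree H)"
  have "sorted_wrt (<) (restr x n)" "set (restr x n) \<subseteq> H" for n
    using x by (auto simp: branches_def increasing_tree_def)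
  note * = this[of "Suc (Suc _)"]
  have "x k < x (Suc k)" "x k \<in> H" for k
    using *[of k] by (auto simp: restr_Suc sorted_wrt_append)
  then show "x \<in> {x. strict_mono x \<and> range x \<subseteq> H}" by (auto simp: strict_mono_Suc_iff)
qed (auto simp: branches_def increasing_tree_def sorted_restr set_restr)

lemma infinite_increasing_successors:
  assumes "infinite H" "u \<in> increasing_tree H"
  shows "infinite {n. u @ [n] \<in> increasing_tree H}"
proof -
  have "above u H \<subseteq> {n. u @ [n] \<in> increasing_tree H}"
    using assms(2) by (auto simp: above_def increasing_tree_def sorted_wrt_append)
  then show ?thesis using infinite_above[OF assms(1)] infinite_super by blast
qed

definition child :: "nat list set \<Rightarrow> nat list \<Rightarrow> nat \<Rightarrow> nat" where
  "child T t = enumerate {i. t @ [i] \<in> T}"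

lemma child:
  assumes "omega_splitting_node T t"
  shows "t @ [child T t n] \<in> T" "child T t m = child T t n \<Longrightarrow> m = n"
proof -
  have "imm_succs T t = (\<lambda>i. t @ [i]) ` {i. t @ [i] \<in> T}" by (auto simp: imm_succs_def)
  then have inf: "infinite {i. t @ [i] \<in> T}"
    using assms unfolding omega_splitting_node_def by (metis finite_imageI)
  show "t @ [child T t n] \<in> T" using enumerate_in_set[OF inf] by (simp add: child_def)
  show "child T t m = child T t n \<Longrightarrow> m = n"
    using strict_mono_enumerate[OF inf] unfolding child_def by (simp add: strict_mono_eq)
qed

lemma omega_splitting_imp_splitting:
  assumes "omega_splitting_node T t"
  shows "splitting_node T t"
proof -
  have inf: "t \<in> T" "infinite (imm_succs T t)" using assms by (auto simp: omega_splitting_node_def)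
  then obtain u where "u \<in> imm_succs T t" using infinite_imp_nonempty by blast
  moreover obtain v where "v \<in> imm_succs T t - {u}"
    using inf(2) infinite_imp_nonempty[of "imm_succs T t - {u}"] by auto
  ultimately show ?thesis using inf(1) unfolding splitting_node_def by blast
qed

lemma (in tree_copy) omega_splitting_copy:
  assumes "is_tree U" "u \<in> U" "infinite {n. u @ [n] \<in> U}"
  shows "omega_splitting_node (copy U) (e u)"
proof -
  have "inj_on (\<lambda>n. e u @ [c u n]) {n. u @ [n] \<in> U}" by (auto intro!: inj_onI c_inj)
  then show ?thesis
    unfolding omega_splitting_node_def imm_succs_copy[OF assms(1,2)]
    using assms by (simp add: e_in_copy finite_image_iff)
qed

text \<open>
  The copy branches only at the images of increasing sequences in \<open>H\<close>, and there in infinitely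
  many directions, since \<open>H\<close> is infinite.
\<close>

lemma copy_increasing_tree_miller:
  assumes "tree_copy e c" "infinite H"
  shows "tree_copy.copy e (increasing_tree H) \<in> miller"
proof -
  interpret tree_copy e c by (rule assms(1))
  show ?thesis
    unfolding miller_def
  proof (intro CollectI conjI allI impI ballI)
    let ?U = "increasing_tree H"
    show "is_tree (copy ?U)" by (rule is_tree_copy[OF is_tree_increasing])
    note omega = omega_splitting_copy[OF is_tree_increasing _ infinite_increasing_successors[OF assms(2)]]
    show "omega_splitting_node (copy ?U) t" if "splitting_node (copy ?U) t" for t
      using splitting_node_copyD[OF is_tree_increasing that] omega by blast
    fix t assume "t \<in> copy ?U"
    then obtain u where u: "u \<in> ?U" "prefix t (e u)" by (auto simp: copy_def)
    have "splitting_node (copy ?U) (e u)"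
      using omega[OF u(1) u(1)] by (rule omega_splitting_imp_splitting)
    then show "\<exists>u. prefix t u \<and> splitting_node (copy ?U) u" using u by blast
  qed
qed

lemma miller_measurable: "analytic_set A \<Longrightarrow> forcing_measurable miller (\<subseteq>) branches A"
proof (erule forcing_measurableI)
  fix M assume "M \<in> miller"
  then have M: "is_tree M" "\<And>t. splitting_node M t \<Longrightarrow> omega_splitting_node M t"
      "\<And>t. t \<in> M \<Longrightarrow> \<exists>u. prefix t u \<and> splitting_node M u"
    by (auto simp: miller_def)
  let ?G = "{t. splitting_node M t}"
  obtain s where s: "s \<in> ?G" using M(1,3) unfolding is_tree_def by blast
  have "\<exists>t'\<in>?G. prefix (t @ [child M t n]) t'" if "t \<in> ?G" for t n
    using that M(2,3) child(1) by blast
  then obtain g where g: "\<And>t n. t \<in> ?G \<Longrightarrow> g t n \<in> ?G \<and> prefix (t @ [child M t n]) (g t n)"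
    by metis
  define e where "e = foldl g s"
  have "?G \<subseteq> M" by (auto simp: splitting_node_def)
  have inj: "\<And>t m n. t \<in> ?G \<Longrightarrow> child M t m = child M t n \<Longrightarrow> m = n"
    using M(2) child(2) by blast
  have e: "tree_copy e (\<lambda>u. child M (e u))" "tree_copy.copy e U \<subseteq> M" for U
    unfolding e_def using tree_copy_foldl(2,3)[OF M(1) \<open>?G \<subseteq> M\<close> s, of g "child M"] g inj by simp_all
  interpret tree_copy e "\<lambda>u. child M (e u)" by (rule e(1))
  show "\<exists>\<phi> :: (nat \<Rightarrow> nat) \<Rightarrow> nat \<Rightarrow> nat. continuous_on UNIV \<phi> \<and> (\<forall>H. infinite H \<longrightarrow>
      (\<exists>p'\<in>miller. p' \<subseteq> M \<and> branches p' \<subseteq> \<phi> ` {x. strict_mono x \<and> range x \<subseteq> H}))"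
  proof (intro exI conjI allI impI bexI)
    show "continuous_on UNIV limit"
      by (rule continuous_if_locally_determined) (use limit_cong in blast)
    fix H :: "nat set" assume "infinite H"
    then show "copy (increasing_tree H) \<in> miller" using copy_increasing_tree_miller e(1) by blast
    show "copy (increasing_tree H) \<subseteq> M" by (rule e(2))
    show "branches (copy (increasing_tree H)) \<subseteq> limit ` {x. strict_mono x \<and> range x \<subseteq> H}"
      using branches_copy[OF is_tree_increasing] branches_increasing by metis
  qed
qed

lemma laver_measurable: "analytic_set A \<Longrightarrow> forcing_measurable laver (\<subseteq>) branches A"
proof (erule forcing_measurableI)
  fix L assume "L \<in> laver"
  then obtain s where L: "is_tree L" "s \<in> L" "\<And>t. t \<in> L \<Longrightarrow> prefix s t \<Longrightarrow> omega_splitting_node L t"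
    by (auto simp: laver_def)
  define G where "G = {t \<in> L. prefix s t}"
  have omega: "omega_splitting_node L t" if "t \<in> G" for t using that L(3) by (simp add: G_def)
  define g where "g t n = t @ [child L t n]" for t n
  \<comment> \<open>A Laver tree splits everywhere above its stem, so the embedding proceeds one level at a
    time and skips no node.\<close>
  define e where "e = foldl g s"
  have e_snoc: "e (u @ [n]) = e u @ [child L (e u) n]" and e_Nil: "e [] = s" for u n
    by (simp_all add: e_def g_def)
  have "G \<subseteq> L" "s \<in> G" using L(2) by (auto simp: G_def)
  have "g t n \<in> G \<and> prefix (t @ [child L t n]) (g t n)" if "t \<in> G" for t n
    using child(1)[OF omega[OF that]] that by (simp add: G_def g_def)
  then have e: "e u \<in> G" "tree_copy e (\<lambda>u. child L (e u))" "tree_copy.copy e U \<subseteq> L" for u U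
    unfolding e_def
    using tree_copy_foldl[OF L(1) \<open>G \<subseteq> L\<close> \<open>s \<in> G\<close>, of g "child L"] child(2)[OF omega] by simp_all
  interpret tree_copy e "\<lambda>u. child L (e u)" by (rule e(2))
  have on_path: "\<exists>v. prefix v u \<and> t = e v" if "prefix s t" "prefix t (e u)" for t u
    using that(2)
  proof (induction u rule: rev_induct)
    case Nil
    then show ?case using that(1) e_Nil by auto
  next
    case (snoc n u)
    then show ?case by (auto simp: e_snoc intro: prefix_order.trans)
  qed
  show "\<exists>\<phi> :: (nat \<Rightarrow> nat) \<Rightarrow> nat \<Rightarrow> nat. continuous_on UNIV \<phi> \<and> (\<forall>H. infinite H \<longrightarrow>
      (\<exists>p'\<in>laver. p' \<subseteq> L \<and> branches p' \<subseteq> \<phi> ` {x. strict_mono x \<and> range x \<subseteq> H}))"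
  proof (intro exI conjI allI impI bexI)
    show "continuous_on UNIV limit"
      by (rule continuous_if_locally_determined) (use limit_cong in blast)
    fix H :: "nat set" assume H: "infinite H"
    let ?U = "increasing_tree H"
    show "copy ?U \<subseteq> L" by (rule e(3))
    show "branches (copy ?U) \<subseteq> limit ` {x. strict_mono x \<and> range x \<subseteq> H}"
      using branches_copy[OF is_tree_increasing] branches_increasing by metis
    show "copy ?U \<in> laver"
      unfolding laver_def
    proof (intro CollectI conjI bexI ballI impI)
      show "is_tree (copy ?U)"
        by (rule is_tree_copy[OF is_tree_increasing])
      show "s \<in> copy ?U" using e_in_copy[of "[]" ?U] e_Nil by (simp add: increasing_tree_def)
      fix t assume "t \<in> copy ?U"
      then obtain u where u: "u \<in> ?U" "prefix t (e u)" by (auto simp: copy_def)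
      then show "prefix s t \<or> prefix t s"
        using e(1)[of u] prefix_same_cases by (auto simp: G_def)
      assume "prefix s t"
      then obtain v where "prefix v u" "t = e v" using on_path u(2) by blast
      moreover have "v \<in> ?U" using \<open>prefix v u\<close> u(1) is_tree_increasing unfolding is_tree_def by blast
      ultimately show "omega_splitting_node (copy ?U) t"
        using omega_splitting_copy[OF is_tree_increasing _ infinite_increasing_successors[OF H]] by blast
    qed
  qed
qed

section \<open>Cubes\<close>

text \<open>
  A partial function \<open>f\<close> determines the cube of all its total extensions; the places outside
  \<open>dom f\<close> are free.
\<close>

definition cube_tree :: "(nat \<rightharpoonup> bool) \<Rightarrow> bool list set" where
  "cube_tree f = {t. \<forall>k<length t. \<forall>b. f k = Some b \<longrightarrow> t ! k = b}"

lemma Nil_cube_tree [simp]: "[] \<in> cube_tree f"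
  by (simp add: cube_tree_def)

lemma snoc_cube_tree:
  "t @ [i] \<in> cube_tree f \<longleftrightarrow> t \<in> cube_tree f \<and> (\<forall>b. f (length t) = Some b \<longrightarrow> i = b)"
  by (auto simp: cube_tree_def nth_append less_Suc_eq)

lemma is_tree_cube_tree: "is_tree (cube_tree f)"
  unfolding is_tree_def
proof (intro conjI ballI allI impI)
  show "cube_tree f \<noteq> {}" using Nil_cube_tree by blast
  show "s \<in> cube_tree f" if "t \<in> cube_tree f" "prefix s t" for s t
    using that unfolding cube_tree_def prefix_def by (auto simp: nth_append) (metis trans_less_add1)+
qed

lemma branches_cube_tree: "branches (cube_tree f) = {z. f \<subseteq>\<^sub>m (\<lambda>n. Some (z n))}"
proof (intro set_eqI iffI)
  fix z assume z: "z \<in> branches (cube_tree f)"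
  have "f k = Some (z k)" if k: "f k = Some b" for k b
  proof -
    have "restr z (Suc k) \<in> cube_tree f" using z unfolding branches_def by blast
    then show ?thesis using k by (auto simp: restr_Suc snoc_cube_tree)
  qed
  then show "z \<in> {z. f \<subseteq>\<^sub>m (\<lambda>n. Some (z n))}" by (force simp: map_le_def)
next
  fix z assume "z \<in> {z. f \<subseteq>\<^sub>m (\<lambda>n. Some (z n))}"
  then have "f k = Some b \<Longrightarrow> z k = b" for k b by (force simp: map_le_def)
  then show "z \<in> branches (cube_tree f)" by (auto simp: branches_def cube_tree_def)
qed

lemma cube_tree_mono: "f \<subseteq>\<^sub>m g \<Longrightarrow> cube_tree g \<subseteq> cube_tree f"
proof
  fix t assume "f \<subseteq>\<^sub>m g" "t \<in> cube_tree g"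
  moreover have "g k = Some b" if "f k = Some b" for k b
    using \<open>f \<subseteq>\<^sub>m g\<close> that unfolding map_le_def by (metis domI)
  ultimately show "t \<in> cube_tree f" unfolding cube_tree_def by blast
qed

lemma cube_tree_extend:
  assumes "t \<in> cube_tree f" "infinite (- dom f)"
  shows "\<exists>u. prefix t u \<and> u \<in> cube_tree f \<and> (\<forall>i. u @ [i] \<in> cube_tree f)"
proof -
  obtain k where k: "k \<ge> length t" "f k = None"
    using assms(2) by (metis ComplD domIff infinite_nat_iff_unbounded_le)
  have "\<exists>u. prefix t u \<and> u \<in> cube_tree f \<and> length u = k"
    using k(1)
  proof (induction rule: dec_induct)
    case base
    then show ?case using assms(1) by blast
  next
    case (step n)
    then obtain u where "prefix t u" "u \<in> cube_tree f" "length u = n" by blast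
    then have "prefix t (u @ [f n = Some True])" "u @ [f n = Some True] \<in> cube_tree f"
      "length (u @ [f n = Some True]) = Suc n"
      by (auto simp: snoc_cube_tree)
    then show ?case by blast
  qed
  then show ?thesis using k(2) by (force simp: snoc_cube_tree)
qed

text \<open>
  For increasing \<open>x\<close> this is the indicator of the range; bounding the index makes the value at \<open>k\<close>
  depend only on finitely many entries, so that the map is continuous everywhere.
\<close>

definition indicator_seq :: "(nat \<Rightarrow> nat) \<Rightarrow> nat \<Rightarrow> bool" where
  "indicator_seq x k \<longleftrightarrow> (\<exists>i\<le>k. x i = k)"

lemma indicator_seq: "strict_mono x \<Longrightarrow> indicator_seq x = (\<lambda>k. k \<in> range x)"
  unfolding indicator_seq_def fun_eq_iff using strict_mono_imp_increasing by blast

lemma indicator_seq_cong: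
  "restr x (Suc k) = restr x' (Suc k) \<Longrightarrow> indicator_seq x k = indicator_seq x' k"
  unfolding indicator_seq_def restr_cong_iff less_Suc_eq_le by metis

text \<open>
  Fix every second element of \<open>H\<close> to be a member, exclude everything outside \<open>H\<close>, and leave the
  rest free. Every set in this cube is an infinite subset of \<open>H\<close>.
\<close>

lemma cube_of_subsets:
  assumes "infinite H"
  shows "\<exists>f. infinite (- dom f) \<and>
    branches (cube_tree f) \<subseteq> indicator_seq ` {x. strict_mono x \<and> range x \<subseteq> H}"
proof -
  let ?h = "enumerate H"
  have h: "inj ?h" "range ?h = H"
    using assms by (auto simp: strict_mono_enumerate strict_mono_imp_inj_on range_enumerate)
  define f where "f k = (if k \<notin> H then Some False else if k \<in> ?h ` {i. even i} then Some True else None)" for k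
  have "infinite {i :: nat. odd i}"
    by (metis infinite_nat_iff_unbounded mem_Collect_eq odd_Suc_minus_one lessI less_SucI even_Suc)
  then have "infinite (?h ` {i. odd i})"
    using h(1) by (meson finite_imageD inj_on_subset subset_UNIV)
  moreover have "?h ` {i. odd i} \<subseteq> - dom f"
    using h by (auto simp: f_def dom_def inj_eq split: if_splits)
  ultimately have "infinite (- dom f)" using infinite_super by blast
  moreover have "z \<in> indicator_seq ` {x. strict_mono x \<and> range x \<subseteq> H}"
    if z: "z \<in> branches (cube_tree f)" for z
  proof -
    have zf: "f k = Some b \<Longrightarrow> z k = b" for k b
      using z unfolding branches_cube_tree by (force simp: map_le_def)
    define I where "I = {k. z k}"
    have "I \<subseteq> H"
    proof
      fix k assume "k \<in> I"
      then have "f k \<noteq> Some False" using zf[of k False] by (auto simp: I_def)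
      then show "k \<in> H" by (auto simp: f_def split: if_splits)
    qed
    have "?h ` {i. even i} \<subseteq> I"
    proof
      fix k assume k: "k \<in> ?h ` {i. even i}"
      then have "k \<in> H" using h(2) by blast
      then have "f k = Some True" using k by (simp add: f_def)
      then show "k \<in> I" using zf by (simp add: I_def)
    qed
    moreover have "infinite {i :: nat. even i}"
      by (metis infinite_nat_iff_unbounded mem_Collect_eq lessI less_SucI even_Suc)
    then have "infinite (?h ` {i. even i})"
      using h(1) by (meson finite_imageD inj_on_subset subset_UNIV)
    ultimately have "infinite I" using infinite_super by blast
    then have "strict_mono (enumerate I)" "range (enumerate I) = I"
      by (auto simp: strict_mono_enumerate range_enumerate)
    moreover from this have "indicator_seq (enumerate I) = z"
      by (simp add: indicator_seq I_def)
    ultimately show ?thesis using \<open>I \<subseteq> H\<close> by blast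
  qed
  ultimately show ?thesis by blast
qed

section \<open>Sacks forcing\<close>

lemma binary_splitting_node:
  fixes P :: "bool list set"
  assumes "splitting_node P t"
  shows "t @ [i] \<in> P"
proof -
  obtain u v where "u \<in> imm_succs P t" "v \<in> imm_succs P t" "u \<noteq> v"
    using assms unfolding splitting_node_def by blast
  moreover obtain a where "u = t @ [a]" "u \<in> P"
    using calculation(1) unfolding imm_succs_def by blast
  moreover obtain b where "v = t @ [b]" "v \<in> P"
    using calculation(2) unfolding imm_succs_def by blast
  ultimately show ?thesis by (cases "i = a") auto
qed

text \<open>
  A perfect tree contains a copy of the full binary tree, embedded along splitting nodes, and the
  copy of a cube with infinitely many free places is perfect.
\<close>

lemma sacks_measurable: "analytic_set A \<Longrightarrow> forcing_measurable sacks (\<subseteq>) branches A"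
proof (erule forcing_measurableI)
  fix P assume "P \<in> sacks"
  then have P: "is_tree P" "\<And>t. t \<in> P \<Longrightarrow> \<exists>u. prefix t u \<and> splitting_node P u"
    by (auto simp: sacks_def)
  let ?G = "{t. splitting_node P t}"
  obtain s where s: "s \<in> ?G" using P unfolding is_tree_def by blast
  have both: "t @ [i] \<in> P" if "t \<in> ?G" for t i
    using that binary_splitting_node by blast
  then have "\<exists>t'\<in>?G. prefix (t @ [i]) t'" if "t \<in> ?G" for t i
    using that P(2) by blast
  then obtain g where g: "\<And>t i. t \<in> ?G \<Longrightarrow> g t i \<in> ?G \<and> prefix (t @ [i]) (g t i)"
    by metis
  define e where "e = foldl g s"
  have "?G \<subseteq> P" by (auto simp: splitting_node_def)
  have e: "tree_copy e (\<lambda>u i. i)" "tree_copy.copy e U \<subseteq> P" for U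
    unfolding e_def using tree_copy_foldl(2,3)[OF P(1) \<open>?G \<subseteq> P\<close> s, of g "\<lambda>t i. i"] g by simp_all
  interpret tree_copy e "\<lambda>u i. i" by (rule e(1))
  have cont: "continuous_on UNIV (\<lambda>x. limit (indicator_seq x))"
  proof (rule continuous_if_locally_determined)
    fix k
    have "limit (indicator_seq x) k = limit (indicator_seq y) k" if "restr x (Suc k) = restr y (Suc k)" for x y
    proof (rule limit_cong)
      show "restr (indicator_seq x) (Suc k) = restr (indicator_seq y) (Suc k)"
        unfolding restr_cong_iff
      proof (intro allI impI)
        fix j assume "j < Suc k"
        then have "restr x (Suc j) = restr y (Suc j)" using that by (simp add: restr_cong_iff)
        then show "indicator_seq x j = indicator_seq y j" by (rule indicator_seq_cong)
      qed
    qed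
    then show "\<exists>m. \<forall>x y. restr x m = restr y m \<longrightarrow>
        limit (indicator_seq x) k = limit (indicator_seq y) k" by blast
  qed
  have "\<exists>p'\<in>sacks. p' \<subseteq> P \<and>
      branches p' \<subseteq> (\<lambda>x. limit (indicator_seq x)) ` {x. strict_mono x \<and> range x \<subseteq> H}"
    if "infinite H" for H
  proof -
    obtain f where f: "infinite (- dom f)"
        "branches (cube_tree f) \<subseteq> indicator_seq ` {x. strict_mono x \<and> range x \<subseteq> H}"
      using cube_of_subsets[OF \<open>infinite H\<close>] by blast
    let ?U = "cube_tree f"
    have "\<exists>u. prefix t u \<and> splitting_node (copy ?U) u" if t: "t \<in> copy ?U" for t
    proof -
      obtain v where v: "v \<in> ?U" "prefix t (e v)" using t by (auto simp: copy_def)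
      obtain u where u: "prefix v u" "u \<in> ?U" "\<And>i. u @ [i] \<in> ?U"
        using cube_tree_extend[OF v(1) f(1)] by blast
      have "imm_succs (copy ?U) (e u) = range (\<lambda>i. e u @ [i])"
        using imm_succs_copy[OF is_tree_cube_tree u(2)] u(3) by simp
      then have "splitting_node (copy ?U) (e u)"
        using e_in_copy[OF u(2)] unfolding splitting_node_def by auto
      then show ?thesis using v(2) e_mono[OF u(1)] prefix_order.trans by blast
    qed
    then have "copy ?U \<in> sacks" using is_tree_copy[OF is_tree_cube_tree] by (simp add: sacks_def)
    moreover have "branches (copy ?U) \<subseteq> (\<lambda>x. limit (indicator_seq x)) ` {x. strict_mono x \<and> range x \<subseteq> H}"
      using branches_copy[OF is_tree_cube_tree[of f]] f(2) by fastforce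
    ultimately show ?thesis using e(2) by blast
  qed
  then show "\<exists>\<phi> :: (nat \<Rightarrow> nat) \<Rightarrow> nat \<Rightarrow> bool. continuous_on UNIV \<phi> \<and> (\<forall>H. infinite H \<longrightarrow>
      (\<exists>p'\<in>sacks. p' \<subseteq> P \<and> branches p' \<subseteq> \<phi> ` {x. strict_mono x \<and> range x \<subseteq> H}))"
    using cont by blast
qed

section \<open>Willowtree and Silver forcing\<close>

text \<open>
  Elements of the body of \<open>(f, A)\<close> correspond to sequences of bits, one for each block of \<open>A\<close>. A
  cube of such sequences corresponds to keeping the blocks at the free places and adding the
  others to the domain with the prescribed value. The additional conclusions \<open>A' \<subseteq> A\<close> and
  \<open>f \<subseteq>\<^sub>m f'\<close> serve the application to Silver trees.
\<close>

lemma willowtree_thinning: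
  assumes "(f, A) \<in> willowtree"
  obtains \<phi> :: "(nat \<Rightarrow> nat) \<Rightarrow> nat \<Rightarrow> bool" where "continuous_on UNIV \<phi>"
    "\<And>H. infinite H \<Longrightarrow> \<exists>f' A'. (f', A') \<in> willowtree \<and> A' \<subseteq> A \<and> f \<subseteq>\<^sub>m f' \<and>
      willowtree_body (f', A') \<subseteq> willowtree_body (f, A) \<and>
      willowtree_body (f', A') \<subseteq> \<phi> ` {x. strict_mono x \<and> range x \<subseteq> H}"
proof -
  have A: "infinite A" "disjoint A" "\<And>a. a \<in> A \<Longrightarrow> finite a \<and> a \<noteq> {}" "dom f = UNIV - \<Union>A"
    using assms by (auto simp: willowtree_def)
  have "countable A"
    using countable_subset[of A "Collect finite"] countable_Collect_finite A(3) by blast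
  then obtain a :: "nat \<Rightarrow> nat set" where a: "inj a" "range a = A"
    using bij_betw_from_nat_into[OF _ A(1)] unfolding bij_betw_def by blast
  have a_eq: "i = j" if "m \<in> a i" "m \<in> a j" for i j m
    using that a A(2) unfolding disjoint_def by (metis disjoint_iff injD rangeI)
  define idx where "idx m = (THE i. m \<in> a i)" for m
  have idx: "idx m = i" if "m \<in> a i" for m i
    unfolding idx_def using that a_eq by blast
  define \<phi> where "\<phi> x m = (if m \<in> \<Union>A then indicator_seq x (idx m) else the (f m))" for x m
  have "continuous_on UNIV \<phi>"
  proof (rule continuous_if_locally_determined)
    fix m
    show "\<exists>n. \<forall>x y. restr x n = restr y n \<longrightarrow> \<phi> x m = \<phi> y m"
      unfolding \<phi>_def using indicator_seq_cong by metis
  qed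
  moreover have "\<exists>f' A'. (f', A') \<in> willowtree \<and> A' \<subseteq> A \<and> f \<subseteq>\<^sub>m f' \<and>
      willowtree_body (f', A') \<subseteq> willowtree_body (f, A) \<and>
      willowtree_body (f', A') \<subseteq> \<phi> ` {x. strict_mono x \<and> range x \<subseteq> H}"
    if "infinite H" for H
  proof -
    obtain h where h: "infinite (- dom h)"
        "branches (cube_tree h) \<subseteq> indicator_seq ` {x. strict_mono x \<and> range x \<subseteq> H}"
      using cube_of_subsets[OF \<open>infinite H\<close>] by blast
    define f' where "f' m = (if m \<in> \<Union>A then h (idx m) else f m)" for m
    define A' where "A' = a ` (- dom h)"
    have "A' \<subseteq> A" using a(2) by (auto simp: A'_def)
    have f'_a: "f' m = h i" if "m \<in> a i" for m i
      using that idx a(2) by (auto simp: f'_def)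
    have "f \<subseteq>\<^sub>m f'" using A(4) by (auto simp: map_le_def f'_def)
    have "dom f' = UNIV - \<Union>A'"
    proof (intro set_eqI)
      fix m
      show "m \<in> dom f' \<longleftrightarrow> m \<in> UNIV - \<Union>A'"
      proof (cases "m \<in> \<Union>A")
        case True
        then obtain i where i: "m \<in> a i" using a(2) by auto
        have "m \<in> \<Union>A' \<longleftrightarrow> h i = None"
        proof
          assume "m \<in> \<Union>A'"
          then obtain j where "m \<in> a j" "h j = None" by (auto simp: A'_def)
          then show "h i = None" using a_eq[OF i] by simp
        next
          assume "h i = None"
          then have "a i \<in> A'" by (auto simp: A'_def)
          then show "m \<in> \<Union>A'" using i by blast
        qed
        then show ?thesis using f'_a[OF i] by auto
      next
        case False
        then have "m \<in> dom f" "m \<notin> \<Union>A'" using A(4) \<open>A' \<subseteq> A\<close> by blast+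
        then show ?thesis using False by (simp add: f'_def domIff)
      qed
    qed
    moreover have "infinite A'"
      unfolding A'_def using h(1) a(1) by (meson finite_imageD inj_on_subset subset_UNIV)
    moreover have "disjoint A'" using A(2) \<open>A' \<subseteq> A\<close> by (auto simp: disjoint_def)
    ultimately have cond: "(f', A') \<in> willowtree" using A(3) \<open>A' \<subseteq> A\<close> by (auto simp: willowtree_def)
    have body: "z \<in> willowtree_body (f, A) \<and> z \<in> \<phi> ` {x. strict_mono x \<and> range x \<subseteq> H}"
      if z: "z \<in> willowtree_body (f', A')" for z
    proof -
      have f'z: "f' \<subseteq>\<^sub>m (\<lambda>n. Some (z n))" and z2: "\<forall>a\<in>A'. \<forall>m\<in>a. \<forall>n\<in>a. z m = z n"
        using z unfolding willowtree_body_def prod.case mem_Collect_eq by blast+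
      have z1: "z m = b" if "f' m = Some b" for m b
      proof -
        have "m \<in> dom f'" using that by blast
        then show ?thesis using f'z that by (simp add: map_le_def)
      qed
      have const: "z m = z n" if "m \<in> a i" "n \<in> a i" for i m n
      proof (cases "h i")
        case None
        then have "a i \<in> A'" by (simp add: A'_def domIff)
        then show ?thesis using that z2 by blast
      next
        case (Some b)
        then have "f' m = Some b" "f' n = Some b" using f'_a that by simp_all
        then show ?thesis using z1 by simp
      qed
      have zf: "f \<subseteq>\<^sub>m (\<lambda>n. Some (z n))"
        using map_le_trans[OF \<open>f \<subseteq>\<^sub>m f'\<close> f'z] .
      define y where "y i = z (SOME m. m \<in> a i)" for i
      have y: "y i = z m" if "m \<in> a i" for i m
        unfolding y_def using const[OF someI[of "\<lambda>m. m \<in> a i"]] that by blast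
      have "h \<subseteq>\<^sub>m (\<lambda>n. Some (y n))"
        unfolding map_le_def
      proof
        fix i assume "i \<in> dom h"
        then obtain b where b: "h i = Some b" by blast
        obtain m where m: "m \<in> a i" using A(3) a(2) by blast
        then show "h i = Some (y i)" using y[OF m] z1 f'_a[OF m] b by simp
      qed
      then obtain x where x: "strict_mono x" "range x \<subseteq> H" "y = indicator_seq x"
        using h(2) unfolding branches_cube_tree by blast
      have "\<phi> x m = z m" for m
      proof (cases "m \<in> \<Union>A")
        case True
        then obtain i where "m \<in> a i" using a(2) by auto
        then show ?thesis using True idx y x(3) by (simp add: \<phi>_def)
      next
        case False
        then have "m \<in> dom f" using A(4) by blast
        then show ?thesis using False zf by (force simp: \<phi>_def map_le_def)
      qed
      then have "z = \<phi> x" by (simp add: fun_eq_iff)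
      moreover have "z \<in> willowtree_body (f, A)"
      proof -
        have "\<forall>b\<in>A. \<forall>m\<in>b. \<forall>n\<in>b. z m = z n" using const a(2) by blast
        then show ?thesis
          using zf unfolding willowtree_body_def prod.case mem_Collect_eq by (rule conjI[rotated])
      qed
      ultimately show ?thesis using x(1,2) by blast
    qed
    show ?thesis
      using cond \<open>A' \<subseteq> A\<close> \<open>f \<subseteq>\<^sub>m f'\<close> body by (intro exI[of _ f'] exI[of _ A'] conjI subsetI) auto
  qed
  ultimately show thesis using that by blast
qed

lemma willowtree_measurable:
  "analytic_set A \<Longrightarrow> forcing_measurable willowtree willowtree_le willowtree_body A"
proof (erule forcing_measurableI)
  fix p assume "p \<in> willowtree"
  then obtain f B where p: "p = (f, B)" "(f, B) \<in> willowtree" by (cases p) auto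
  obtain \<phi> :: "(nat \<Rightarrow> nat) \<Rightarrow> nat \<Rightarrow> bool" where \<phi>: "continuous_on UNIV \<phi>"
    "\<And>H. infinite H \<Longrightarrow> \<exists>f' B'. (f', B') \<in> willowtree \<and> B' \<subseteq> B \<and> f \<subseteq>\<^sub>m f' \<and>
      willowtree_body (f', B') \<subseteq> willowtree_body (f, B) \<and>
      willowtree_body (f', B') \<subseteq> \<phi> ` {x. strict_mono x \<and> range x \<subseteq> H}"
    using willowtree_thinning[OF p(2)] by blast
  then show "\<exists>\<phi> :: (nat \<Rightarrow> nat) \<Rightarrow> nat \<Rightarrow> bool. continuous_on UNIV \<phi> \<and> (\<forall>H. infinite H \<longrightarrow>
      (\<exists>p'\<in>willowtree. willowtree_le p' p \<and>
        willowtree_body p' \<subseteq> \<phi> ` {x. strict_mono x \<and> range x \<subseteq> H}))"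
    unfolding p(1) willowtree_le_def by (intro exI[of _ \<phi>]) blast
qed

text \<open>
  The next two lemmas identify Silver trees with the trees of cubes: by uniformity, which values
  are possible at a level does not depend on the node.
\<close>

lemma cube_tree_silver: "infinite (- dom f) \<Longrightarrow> cube_tree f \<in> silver"
proof -
  assume f: "infinite (- dom f)"
  have "\<exists>u. prefix t u \<and> splitting_node (cube_tree f) u" if t: "t \<in> cube_tree f" for t
  proof -
    obtain u where "prefix t u" "u \<in> cube_tree f" "\<And>i. u @ [i] \<in> cube_tree f"
      using cube_tree_extend[OF t f] by blast
    moreover from this have "u @ [True] \<in> imm_succs (cube_tree f) u" "u @ [False] \<in> imm_succs (cube_tree f) u"
      by (auto simp: imm_succs_def)
    ultimately show ?thesis unfolding splitting_node_def by blast
  qed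
  then have "cube_tree f \<in> sacks" using is_tree_cube_tree by (simp add: sacks_def)
  then show ?thesis by (auto simp: silver_def snoc_cube_tree)
qed

lemma silver_eq_cube_tree:
  assumes "P \<in> silver"
  obtains f where "infinite (- dom f)" "P = cube_tree f"
proof -
  have P: "is_tree P" "\<And>t. t \<in> P \<Longrightarrow> \<exists>u. prefix t u \<and> splitting_node P u"
    and uniform: "\<And>t t' i. t \<in> P \<Longrightarrow> t' \<in> P \<Longrightarrow> length t = length t' \<Longrightarrow> t @ [i] \<in> P \<longleftrightarrow> t' @ [i] \<in> P"
  proof -
    have "P \<in> sacks" using assms by (simp add: silver_def)
    then show "is_tree P" "\<And>t. t \<in> P \<Longrightarrow> \<exists>u. prefix t u \<and> splitting_node P u"
      unfolding sacks_def by blast+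
    show "\<And>t t' i. t \<in> P \<Longrightarrow> t' \<in> P \<Longrightarrow> length t = length t' \<Longrightarrow> t @ [i] \<in> P \<longleftrightarrow> t' @ [i] \<in> P"
      using assms unfolding silver_def by blast
  qed
  have prefix_closed: "s \<in> P" if "t \<in> P" "prefix s t" for s t
    using P(1) that unfolding is_tree_def by blast
  have "[] \<in> P" using P(1) unfolding is_tree_def by auto
  have long: "\<exists>t\<in>P. n \<le> length t" for n
  proof (induction n)
    case 0
    then show ?case using \<open>[] \<in> P\<close> by blast
  next
    case (Suc n)
    then obtain t where t: "t \<in> P" "n \<le> length t" by blast
    then obtain u where "prefix t u" "splitting_node P u" using P(2) by blast
    then obtain i where i: "u @ [i] \<in> P" by (auto simp: splitting_node_def imm_succs_def)
    then have "Suc n \<le> length (u @ [i])" using t(2) prefix_length_le[OF \<open>prefix t u\<close>] by simp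
    then show ?case using i by blast
  qed
  define L where "L n i \<longleftrightarrow> (\<exists>t\<in>P. length t = n \<and> t @ [i] \<in> P)" for n i
  have L: "t @ [i] \<in> P \<longleftrightarrow> t \<in> P \<and> L (length t) i" for t i
  proof
    assume "t @ [i] \<in> P"
    then show "t \<in> P \<and> L (length t) i" using prefix_closed[of "t @ [i]" t] unfolding L_def by auto
  next
    assume "t \<in> P \<and> L (length t) i"
    then show "t @ [i] \<in> P" using uniform[of t] unfolding L_def by metis
  qed
  have L_ex: "\<exists>i. L n i" for n
  proof -
    obtain t where t: "t \<in> P" "Suc n \<le> length t" using long by blast
    then have "take n t @ [t ! n] \<in> P"
      using prefix_closed take_is_prefix by (metis Suc_le_lessD take_Suc_conv_app_nth)
    then have "L (length (take n t)) (t ! n)" using L by blast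
    then show ?thesis using t(2) by auto
  qed
  define f where "f n = (if L n True \<and> L n False then None else Some (L n True))" for n
  have f: "L n i \<longleftrightarrow> (\<forall>b. f n = Some b \<longrightarrow> i = b)" for n i
    using L_ex[of n] by (cases i) (auto simp: f_def ex_bool_eq)
  have "t \<in> P \<longleftrightarrow> t \<in> cube_tree f" for t
    by (induction t rule: rev_induct) (simp_all add: \<open>[] \<in> P\<close> L f snoc_cube_tree)
  then have "P = cube_tree f" by blast
  moreover have "infinite (- dom f)"
    unfolding infinite_nat_iff_unbounded_le
  proof
    fix n
    obtain t where t: "t \<in> P" "n \<le> length t" using long by blast
    then obtain u where u: "prefix t u" "splitting_node P u" using P(2) by blast
    have "u @ [i] \<in> P" for i
      using u(2) by (rule binary_splitting_node)
    then have "L (length u) i" for i using L by blast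
    then have "f (length u) = None" by (simp add: f_def)
    moreover have "n \<le> length u" using t(2) prefix_length_le[OF u(1)] by simp
    ultimately show "\<exists>m\<ge>n. m \<in> - dom f" by blast
  qed
  ultimately show thesis using that by blast
qed

lemma silver_measurable: "analytic_set A \<Longrightarrow> forcing_measurable silver (\<subseteq>) branches A"
proof (erule forcing_measurableI)
  fix P assume "P \<in> silver"
  then obtain f where f: "infinite (- dom f)" "P = cube_tree f" by (rule silver_eq_cube_tree)
  define B where "B = (\<lambda>n. {n}) ` (- dom f)"
  have "infinite B" using f(1) by (simp add: B_def finite_image_iff)
  then have "(f, B) \<in> willowtree" by (auto simp: willowtree_def B_def disjoint_def)
  then obtain \<phi> :: "(nat \<Rightarrow> nat) \<Rightarrow> nat \<Rightarrow> bool" where \<phi>: "continuous_on UNIV \<phi>"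
    "\<And>H. infinite H \<Longrightarrow> \<exists>f' B'. (f', B') \<in> willowtree \<and> B' \<subseteq> B \<and> f \<subseteq>\<^sub>m f' \<and>
      willowtree_body (f', B') \<subseteq> willowtree_body (f, B) \<and>
      willowtree_body (f', B') \<subseteq> \<phi> ` {x. strict_mono x \<and> range x \<subseteq> H}"
    using willowtree_thinning by blast
  have "\<exists>p'\<in>silver. p' \<subseteq> P \<and> branches p' \<subseteq> \<phi> ` {x. strict_mono x \<and> range x \<subseteq> H}"
    if H: "infinite H" for H
  proof -
    obtain f' B' where f': "(f', B') \<in> willowtree" "B' \<subseteq> B" "f \<subseteq>\<^sub>m f'"
        "willowtree_body (f', B') \<subseteq> \<phi> ` {x. strict_mono x \<and> range x \<subseteq> H}"
      using \<phi>(2)[OF H] by blast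
    have "infinite B'" "dom f' = UNIV - \<Union>B'" using f'(1) by (auto simp: willowtree_def)
    moreover have "B' = (\<lambda>n. {n}) ` (\<Union>B')" using f'(2) by (force simp: B_def)
    ultimately have "infinite (- dom f')" by (metis Compl_eq_Diff_UNIV double_compl finite_imageI)
    moreover have "cube_tree f' \<subseteq> P" using cube_tree_mono f'(3) f(2) by blast
    moreover have "branches (cube_tree f') = willowtree_body (f', B')"
      using f'(2) by (auto simp: branches_cube_tree willowtree_body_def B_def)
    ultimately show ?thesis using cube_tree_silver f'(4) by blast
  qed
  then show "\<exists>\<phi> :: (nat \<Rightarrow> nat) \<Rightarrow> nat \<Rightarrow> bool. continuous_on UNIV \<phi> \<and> (\<forall>H. infinite H \<longrightarrow>
      (\<exists>p'\<in>silver. p' \<subseteq> P \<and> branches p' \<subseteq> \<phi> ` {x. strict_mono x \<and> range x \<subseteq> H}))"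
    using \<phi>(1) by blast
qed

section \<open>Matet forcing\<close>

lemma block_less_trans:
  assumes "block_less t u" "block_less u v" "u \<noteq> []"
  shows "block_less t v"
proof -
  have "Min (set u) \<le> Max (set u)" using assms(3) by simp
  then show ?thesis using assms unfolding block_less_def by linarith
qed

lemma block_less_irrefl: "t \<noteq> [] \<Longrightarrow> \<not> block_less t t"
  using Min_le[of "set t" "Max (set t)"] unfolding block_less_def
  by (metis List.finite_set Max_in leD set_empty)

text \<open>
  The blocks of a Matet condition after its stem, listed in increasing order. If the stem is
  empty, an enumeration as in the definition may list the empty sequence again, between nonempty
  blocks, and across such a place it does not compare blocks directly. This can happen only
  finitely often: a block followed by the empty sequence lies below the default value of \<open>Min {}\<close>,
  and then so do all blocks since the previous such place. If it happened infinitely often, all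
  blocks would lie below this number, and \<open>A\<close> would be finite. So a tail of the enumeration is as
  required.
\<close>

lemma matet_blocks:
  assumes "(s, A) \<in> matet"
  shows "\<exists>b :: nat \<Rightarrow> nat list. range b \<subseteq> A \<and> (\<forall>i j. block_less (b i) (b j) \<longleftrightarrow> i < j) \<and>
    (\<forall>i. block_less s (b i))"
proof -
  obtain a where A: "infinite A" "\<And>t. t \<in> A \<Longrightarrow> t \<noteq> [] \<and> sorted_wrt (<) t"
    and a: "range a = insert s A" "a 0 = s" "\<And>i. block_less (a i) (a (Suc i))"
    using assms unfolding matet_def mem_Collect_eq prod.case by metis
  obtain N where N: "\<And>i. N \<le> i \<Longrightarrow> a i \<noteq> []" "s \<noteq> [] \<Longrightarrow> N = 0"
  proof (cases "s = []")
    case False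
    then have "a i \<noteq> []" for i using a(1) A(2) by (metis insertE rangeI)
    then show ?thesis using that by blast
  next
    case True
    have "\<exists>N. \<forall>i\<ge>N. a i \<noteq> []"
    proof (rule ccontr)
      assume "\<not> ?thesis"
      then have empty: "\<exists>i\<ge>n. a i = []" for n by blast
      define \<mu> where "\<mu> = Min ({} :: nat set)"
      have bounded: "set (a i) \<subseteq> {..<\<mu>}" for i
      proof -
        obtain j where "i \<le> j" "a j = []" using empty by blast
        from this(1) show ?thesis
        proof (induction rule: inc_induct)
          case base
          then show ?case using \<open>a j = []\<close> by simp
        next
          case (step k)
          show ?case
          proof (cases "a k = []")
            case False
            have "Max (set (a k)) < Min (set (a (Suc k)))"
              using a(3)[of k] False by (simp add: block_less_def)
            moreover have "Min (set (a (Suc k))) \<le> \<mu>"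
            proof (cases "a (Suc k) = []")
              case False
              then have "Min (set (a (Suc k))) \<in> set (a (Suc k))" by simp
              then show ?thesis using step.IH by auto
            qed (simp add: \<mu>_def)
            ultimately have "Max (set (a k)) < \<mu>" by simp
            then show ?thesis using False by (auto simp: Max_less_iff)
          qed simp
        qed
      qed
      have "A \<subseteq> {t. sorted_wrt (<) t \<and> set t \<subseteq> {..<\<mu>}}"
      proof
        fix t assume "t \<in> A"
        then obtain i where "t = a i" using a(1) by blast
        then show "t \<in> {t. sorted_wrt (<) t \<and> set t \<subseteq> {..<\<mu>}}"
          using A(2)[OF \<open>t \<in> A\<close>] bounded[of i] by simp
      qed
      then show False using A(1) finite_increasing_lists[of "{..<\<mu>}"] finite_subset by blast
    qed
    then show ?thesis using that True by blast
  qed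
  have less: "block_less (a i) (a j)" if "N \<le> i" "i < j" for i j
  proof -
    from \<open>i < j\<close> have "Suc i \<le> j" by simp
    then show ?thesis
    proof (induction rule: dec_induct)
      case (step k)
      then show ?case using block_less_trans[OF step.IH a(3)] N(1)[of k] \<open>N \<le> i\<close> by simp
    qed (rule a(3))
  qed
  define b where "b i = a (Suc N + i)" for i
  have b_ne: "b i \<noteq> []" for i unfolding b_def by (rule N(1)) simp
  have b_less: "block_less (b i) (b j)" if "i < j" for i j
    unfolding b_def using that by (intro less) auto
  have b_iff: "block_less (b i) (b j) \<longleftrightarrow> i < j" for i j
    using b_less block_less_irrefl block_less_trans b_ne by (metis linorder_neqE_nat)
  have s_less: "block_less s (b i)" for i
  proof (cases "s = []")
    case False
    then show ?thesis using less[of 0 "Suc i"] N(2) a(2) by (simp add: b_def)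
  qed (simp add: block_less_def)
  have "b i \<in> A" for i
  proof -
    have "b i \<noteq> s" using s_less[of i] block_less_irrefl b_ne by metis
    then show ?thesis using a(1) unfolding b_def by (metis insertE rangeI)
  qed
  then show ?thesis using b_iff s_less by (intro exI[of _ b]) blast
qed

text \<open>
  Keeping the blocks with indices in \<open>H\<close> and concatenating them in order is the map from
  increasing sequences in \<open>H\<close> onto the body of the smaller condition.
\<close>

lemma matet_measurable: "analytic_set A \<Longrightarrow> forcing_measurable matet matet_le matet_body A"
proof (erule forcing_measurableI)
  fix p assume "p \<in> matet"
  then obtain s B where p: "p = (s, B)" "(s, B) \<in> matet" by (cases p) auto
  have B: "sorted_wrt (<) s" "\<And>t. t \<in> B \<Longrightarrow> t \<noteq> [] \<and> sorted_wrt (<) t"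
    using p(2) by (auto simp: matet_def)
  obtain b :: "nat \<Rightarrow> nat list" where b: "range b \<subseteq> B" "\<forall>i j. block_less (b i) (b j) \<longleftrightarrow> i < j"
      "\<forall>i. block_less s (b i)"
    using matet_blocks[OF p(2)] by blast
  have "b i \<noteq> []" for i using B(2) b(1) by blast
  have "inj b"
  proof (rule injI)
    fix i j assume "b i = b j"
    then have "i < j \<longleftrightarrow> i < i" "j < i \<longleftrightarrow> i < i" using b(2) by metis+
    then show "i = j" by simp
  qed
  define e where "e u = s @ concat (map b u)" for u
  have length_e: "length u \<le> length (e u)" for u
  proof (induction u)
    case (Cons n u)
    have "0 < length (b n)" using \<open>b n \<noteq> []\<close> by simp
    moreover have "length (e (n # u)) = length (b n) + length (e u)" by (simp add: e_def)
    moreover have "length (n # u) = Suc (length u)" by simp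
    ultimately show ?case using Cons by linarith
  qed simp
  define \<phi> where "\<phi> x k = e (restr x (Suc k)) ! k" for x k
  have "continuous_on UNIV \<phi>"
  proof (rule continuous_if_locally_determined)
    fix k
    show "\<exists>m. \<forall>x y. restr x m = restr y m \<longrightarrow> \<phi> x k = \<phi> y k"
      unfolding \<phi>_def by metis
  qed
  moreover have "\<exists>p'\<in>matet. matet_le p' p \<and>
      matet_body p' \<subseteq> \<phi> ` {x. strict_mono x \<and> range x \<subseteq> H}" if H: "infinite H" for H
  proof (intro bexI conjI)
    let ?p = "(s, b ` H)"
    show "matet_le ?p p"
      unfolding matet_le_def p(1) prod.case
    proof (intro conjI ballI)
      show "\<exists>bs. set bs \<subseteq> B \<and> t = concat bs" if "t \<in> b ` H" for t
        using that b(1) by (intro exI[of _ "[t]"]) auto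
      show "\<exists>\<beta>s. set \<beta>s \<subseteq> B \<and> set s - set s = set (concat \<beta>s)"
        by (intro exI[of _ "[]"]) simp
    qed simp
    show "?p \<in> matet"
      unfolding matet_def mem_Collect_eq prod.case
    proof (intro conjI)
      show "infinite (b ` H)"
        using H \<open>inj b\<close> by (meson finite_imageD inj_on_subset subset_UNIV)
      show "\<forall>t\<in>b ` H. t \<noteq> [] \<and> sorted_wrt (<) t" using B(2) b(1) by blast
      define a where "a i = (case i of 0 \<Rightarrow> s | Suc i \<Rightarrow> b (enumerate H i))" for i
      have "range a = insert s (b ` H)"
      proof -
        have "range a = insert (a 0) (range (\<lambda>i. a (Suc i)))"
          by (metis UNIV_nat_eq image_insert image_image)
        then show ?thesis using range_enumerate[OF H] by (simp add: a_def image_image[symmetric])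
      qed
      moreover have "block_less (a i) (a (Suc i))" for i
        using b(2,3) enumerate_step[OF H] by (cases i) (auto simp: a_def)
      ultimately show "\<exists>a. range a = insert s (b ` H) \<and> a 0 = s \<and> (\<forall>i. block_less (a i) (a (Suc i)))"
        by (intro exI[of _ a]) (simp add: a_def)
    qed (rule B(1))
    show "matet_body ?p \<subseteq> \<phi> ` {x. strict_mono x \<and> range x \<subseteq> H}"
    proof
      fix z assume "z \<in> matet_body ?p"
      then obtain c where c: "range c \<subseteq> b ` H" "\<And>i. block_less (c i) (c (Suc i))"
          "\<And>n. let u = s @ concat (map c [0..<n]) in restr z (length u) = u"
        unfolding matet_body_def prod.case mem_Collect_eq by blast
      have "\<forall>i. \<exists>n\<in>H. c i = b n" using c(1) by blast
      then obtain x where x: "\<And>i. x i \<in> H" "\<And>i. c i = b (x i)" by metis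
      have "strict_mono x" using c(2) b(2) x(2) by (simp add: strict_mono_Suc_iff)
      moreover have ze: "restr z (length (e (restr x n))) = e (restr x n)" for n
      proof -
        have "e (restr x n) = s @ concat (map c [0..<n])"
        proof -
          have "c = (\<lambda>i. b (x i))" using x(2) by blast
          then show ?thesis by (simp add: e_def restr_def comp_def)
        qed
        then show ?thesis using c(3)[of n] by (simp add: Let_def)
      qed
      have "z k = \<phi> x k" for k
      proof -
        have "k < length (e (restr x (Suc k)))" using length_e[of "restr x (Suc k)"] by simp
        then show ?thesis unfolding \<phi>_def using ze by (metis nth_restr)
      qed
      then have "z = \<phi> x" by (simp add: fun_eq_iff)
      ultimately show "z \<in> \<phi> ` {x. strict_mono x \<and> range x \<subseteq> H}" using x(1) by blast
    qed
  qed
  ultimately show "\<exists>\<phi> :: (nat \<Rightarrow> nat) \<Rightarrow> nat \<Rightarrow> nat. continuous_on UNIV \<phi> \<and> (\<forall>H. infinite H \<longrightarrow>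
      (\<exists>p'\<in>matet. matet_le p' p \<and>
        matet_body p' \<subseteq> \<phi> ` {x. strict_mono x \<and> range x \<subseteq> H}))"
    by blast
qed

theorem theorem3p10:
  shows "(\<forall>A :: (nat \<Rightarrow> bool) set. analytic_set A \<longrightarrow>
            forcing_measurable sacks (\<subseteq>) branches A \<and>
            forcing_measurable silver (\<subseteq>) branches A \<and>
            forcing_measurable willowtree willowtree_le willowtree_body A) \<and>
         (\<forall>A :: (nat \<Rightarrow> nat) set. analytic_set A \<longrightarrow>
            forcing_measurable miller (\<subseteq>) branches A \<and>
            forcing_measurable laver (\<subseteq>) branches A \<and>
            forcing_measurable matet matet_le matet_body A)"
  by (simp add: sacks_measurable silver_measurable willowtree_measurable
      miller_measurable laver_measurable matet_measurable)

end
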